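(* Let $m,n\ge 1$ be integers and $d=m+n$. In the unweighted case (i.e. $r_i=1/m$ and $s_j=1/n$ for all $i=1,\dots,m$ and $j=1,\dots,n$), there exist constants $c_0>0$ and $M_0>0$ depending only on $d$ such that for any $\epsilon>0$ and any $b\in\mathbb{R}^m$, $$\dim_H \mathbf{Bad}^b(\epsilon)\le mn-c_0\,\epsilon^{M_0}.$$
   Context: $M_{m,n}(\mathbb{R})$ is the set of real $m\times n$ matrices (identified with $\mathbb{R}^{mn}$), $\|\cdot\|$ is the supremum norm, and $\langle v\rangle=\inf_{p\in\mathbb{Z}^m}\|v-p\|$ for $v\in\mathbb{R}^m$. The weights are $\mathbf{r}=(r_1,\dots,r_m)$ and $\mathbf{s}=(s_1,\dots,s_n)$; in the unweighted case the associated quasinorms $\max_i|x_i|^{1/r_i}$ on $\mathbb{R}^m$ and $\max_j|y_j|^{1/s_j}$ on $\mathbb{R}^n$ are $\|x\|^m$ and $\|y\|^n$. Accordingly, for $\epsilon>0$ and $b\in\mathbb{R}^m$, in the unweighted case, $$\mathbf{Bad}^b(\epsilon)=\Big\{A\in M_{m,n}(\mathbb{R}):\ \liminf_{q\in\mathbb{Z}^n,\ \|q\|\to\infty}\|q\|^n\langle Aq-b\rangle^m\ge\epsilon\Big\}.$$ $\dim_H$ is the Hausdorff dimension with respect to the standard metric.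
   Formalization: The bound is proved as mn − c_0·min(ε,1)^{M_0}: as stated for ε ≤ 1, with the ε = 1 bound for ε > 1, because for large ε the stated bound fails (b = (1/2,…,1/2), A = 0 lies in Bad^b(ε) for every ε, while the right side becomes negative). *)

theory Defs
  imports
    "HOL-Analysis.Abstract_Metric_Spaces"
    "HOL-Analysis.L2_Norm"
    "HOL-Library.Extended_Nonnegative_Real"
    "HOL-Library.Liminf_Limsup"
    "Jordan_Normal_Form.Matrix"
begin

section \<open>Hausdorff dimension in a metric space\<close>

definition mdiam :: "'a metric \<Rightarrow> 'a set \<Rightarrow> ennreal" where
  "mdiam M U = (SUP x\<in>U. SUP y\<in>U. ennreal (mdist M x y))"

text \<open>Covers are sequences of sets, and finite covers are padded with the empty set, which
  contributes \<open>0 powr s = 0\<close>. The passage to the reals is harmless because a set admitted here has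
  diameter at most \<open>\<delta>\<close>. For \<open>s = 0\<close> the formula is not the counting measure, since \<open>0 powr 0 = 0\<close>;
  only \<open>s > 0\<close> is used below.\<close>

definition hausdorff_content :: "'a metric \<Rightarrow> real \<Rightarrow> real \<Rightarrow> 'a set \<Rightarrow> ennreal" where
  "hausdorff_content M s \<delta> S =
     (INF U \<in> {U :: nat \<Rightarrow> 'a set. S \<subseteq> (\<Union>i. U i) \<and> (\<forall>i. U i \<subseteq> mspace M \<and> mdiam M (U i) \<le> ennreal \<delta>)}.
        \<Sum>i. ennreal (enn2real (mdiam M (U i)) powr s))"

definition hausdorff_measure :: "'a metric \<Rightarrow> real \<Rightarrow> 'a set \<Rightarrow> ennreal" where
  "hausdorff_measure M s S = (SUP \<delta>\<in>{0<..}. hausdorff_content M s \<delta> S)"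

text \<open>Restricting the infimum to \<open>s > 0\<close> does not change it: the zero-dimensional measure vanishes
  only on the empty set, on which every \<open>s > 0\<close> qualifies. The empty set has dimension \<open>0\<close>.\<close>

definition hausdorff_dim :: "'a metric \<Rightarrow> 'a set \<Rightarrow> ereal" where
  "hausdorff_dim M S = (INF s \<in> {s. 0 < s \<and> hausdorff_measure M s S = 0}. ereal s)"


section \<open>Real matrices as a Euclidean space\<close>

definition mat_dist :: "nat \<Rightarrow> nat \<Rightarrow> real mat \<Rightarrow> real mat \<Rightarrow> real" where
  "mat_dist m n A B = L2_set (\<lambda>(i, j). A $$ (i, j) - B $$ (i, j)) ({..<m} \<times> {..<n})"

lemma Metric_space_mat: "Metric_space (carrier_mat m n) (mat_dist m n)"
proof
  fix A B :: "real mat"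
  show "0 \<le> mat_dist m n A B"
    by (simp add: mat_dist_def)
  show "mat_dist m n A B = mat_dist m n B A"
    by (simp add: mat_dist_def L2_set_def case_prod_unfold power2_commute)
next
  fix A B :: "real mat"
  assume "A \<in> carrier_mat m n" "B \<in> carrier_mat m n"
  then show "mat_dist m n A B = 0 \<longleftrightarrow> A = B"
    by (auto simp: mat_dist_def L2_set_eq_0_iff intro!: eq_matI)
next
  fix A B C :: "real mat"
  have "mat_dist m n A C = L2_set (\<lambda>p. (A $$ p - B $$ p) + (B $$ p - C $$ p)) ({..<m} \<times> {..<n})"
    by (simp add: mat_dist_def case_prod_unfold)
  also have "\<dots> \<le> mat_dist m n A B + mat_dist m n B C"
    unfolding mat_dist_def case_prod_unfold prod.collapse by (rule L2_set_triangle_ineq)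
  finally show "mat_dist m n A C \<le> mat_dist m n A B + mat_dist m n B C" .
qed

definition mat_metric :: "nat \<Rightarrow> nat \<Rightarrow> real mat metric" where
  "mat_metric m n = metric (carrier_mat m n, mat_dist m n)"

lemma mspace_mat_metric [simp]: "mspace (mat_metric m n) = carrier_mat m n"
  and mdist_mat_metric [simp]: "mdist (mat_metric m n) = mat_dist m n"
  unfolding mat_metric_def
  by (rule Metric_space.mspace_metric[OF Metric_space_mat] Metric_space.mdist_metric[OF Metric_space_mat])+


section \<open>Badly approximable affine forms\<close>

text \<open>All vectors below have positive dimension, so the maximum is over a nonempty set.\<close>

definition sup_norm :: "real vec \<Rightarrow> real" where
  "sup_norm v = (MAX i\<in>{..<dim_vec v}. \<bar>vec_index v i\<bar>)"

definition dist_int :: "real vec \<Rightarrow> real" where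
  "dist_int v = (INF p \<in> carrier_vec (dim_vec v). sup_norm (v - map_vec real_of_int p))"

definition int_vec_at_infinity :: "nat \<Rightarrow> int vec filter" where
  "int_vec_at_infinity n =
     inf (filtercomap (\<lambda>q. sup_norm (map_vec real_of_int q)) at_top) (principal (carrier_vec n))"

definition Bad :: "nat \<Rightarrow> nat \<Rightarrow> real vec \<Rightarrow> real \<Rightarrow> real mat set" where
  "Bad m n b \<epsilon> =
     {A \<in> carrier_mat m n.
        Liminf (int_vec_at_infinity n)
          (\<lambda>q. ereal (sup_norm (map_vec real_of_int q) ^ n
                      * dist_int (A *\<^sub>v map_vec real_of_int q - b) ^ m)) \<ge> ereal \<epsilon>}"

end

theory Submission
  imports Defs "HOL-Analysis.Caratheodory" "HOL-Library.Function_Algebras"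
begin

text \<open>Cut the space of matrices into cubes of side \<open>1 / M\<close> with \<open>M = r ^ ((m + n) * k)\<close>, \<open>r = 2 ^ l\<close>. To the cube
  with corner \<open>A / M\<close> belongs the lattice of all integer vectors \<open>(u, q)\<close> with \<open>u\<close> congruent to \<open>A q\<close>
  modulo \<open>M\<close>, which has index \<open>M ^ m = Y ^ (m + n)\<close> for \<open>Y = r ^ (m * k)\<close>; let \<open>N\<close> be the number of its points
  in the box of radius \<open>Y\<close>. If \<open>N\<close> is bounded, every translate of the lattice has a point in a box
  of radius a bounded multiple of \<open>Y\<close>, so that once \<open>r\<close> exceeds a constant over \<open>\<epsilon>\<close> some subcube of the next
  generation misses the set of badly approximable matrices. If \<open>N\<close> is large, the cube lies in the
  cusp, but there \<open>N\<close> contracts: its average over the subcubes is at most a constant plus a small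
  multiple of \<open>N\<close>, with a constant that does not depend on \<open>r\<close>. Hence the potential
  \<open>1 + \<kappa> * N\<close>, summed over the surviving cubes, grows per generation by a factor of at most \<open>r ^ D - 1 / 2\<close>,
  where \<open>D = (m + n) * m * n\<close>, and this saving is a power of \<open>\<epsilon>\<close>.\<close>

section \<open>Integer lattices of finite index\<close>

text \<open>Divided by \<open>Y\<close>, the lattice is unimodular: it is the image of Z^(m+n) under
  the unipotent matrix of the cube corner followed by the diagonal flow that expands
  \<open>u\<close> and contracts \<open>q\<close>. So \<open>N\<close> counts points in a unit box
  and serves as a Margulis height function. Reduction theory is replaced by counting in the finite
  group Z^(m+n) / L: the number of classes met by a box and the number of lattice points in it bound
  each other. The obstacle is a circularity. A dead subcube requires \<open>r\<close> large in terms
  of the height threshold and of 1 / \<epsilon>, but an additive constant growing with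
  \<open>r\<close> would push the threshold up along with \<open>r\<close>. As the constant depends
  on \<open>m\<close> and \<open>n\<close> only, the threshold is fixed first and \<open>r\<close>
  is chosen last, comparable to 1 / \<epsilon>. The contraction rests on one missing power: up to
  constants, dilating the box by s raises N to at most s^(d-1) N + s^d. Losing half a cube out of
  r^D lowers the dimension by an amount of order 1 / (r^D log r); bounding log r by r leads to the
  final exponent D + 1.\<close>

text \<open>Padding by zero instead of \<open>undefined\<close> makes equality and the pointwise
  operations on functions behave as in Z^d, and lets \<open>vecs\<close> be nested, so that matrices
  are vectors of rows.\<close>

definition vecs :: "nat \<Rightarrow> (nat \<Rightarrow> 'a::zero set) \<Rightarrow> (nat \<Rightarrow> 'a) set" where
  "vecs d S = {z. (\<forall>i<d. z i \<in> S i) \<and> (\<forall>i\<ge>d. z i = 0)}"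

lemma bij_betw_vecs: "bij_betw (\<lambda>z. restrict z {..<d}) (vecs d S) (Pi\<^sub>E {..<d} S)"
proof (rule bij_betw_byWitness[where f' = "\<lambda>z i. if i < d then z i else 0"])
  show "\<forall>z\<in>vecs d S. (\<lambda>i. if i < d then restrict z {..<d} i else 0) = z"
    by (auto simp: vecs_def fun_eq_iff not_less)
  show "\<forall>z\<in>Pi\<^sub>E {..<d} S. restrict (\<lambda>i. if i < d then z i else 0) {..<d} = z"
    by (auto simp: fun_eq_iff PiE_def extensional_def restrict_def)
qed (auto simp: vecs_def PiE_def)

lemma card_vecs: "card (vecs d S) = (\<Prod>i<d. card (S i))"
  using bij_betw_same_card[OF bij_betw_vecs[of d S]] by (simp add: card_PiE)

lemma finite_vecs: "(\<And>i. i < d \<Longrightarrow> finite (S i)) \<Longrightarrow> finite (vecs d S)"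
  using bij_betw_finite[OF bij_betw_vecs[of d S]] finite_PiE[of "{..<d}" S] by simp

lemma card_le_fibres:
  assumes "finite S" and "\<And>y. y \<in> f ` S \<Longrightarrow> card {x \<in> S. f x = y} \<le> k"
  shows "card S \<le> card (f ` S) * k"
proof -
  have "card S = (\<Sum>y\<in>f ` S. card {x \<in> S. f x = y})"
    using sum.image_gen[OF assms(1), of "\<lambda>_. 1::nat" f] by simp
  also have "\<dots> \<le> card (f ` S) * k"
    using sum_bounded_above[of "f ` S" "\<lambda>y. card {x \<in> S. f x = y}" k] assms(2) by simp
  finally show ?thesis .
qed

abbreviation intvecs :: "nat \<Rightarrow> (nat \<Rightarrow> int) set" where
  "intvecs d \<equiv> vecs d (\<lambda>_. UNIV)"

definition int_box :: "nat \<Rightarrow> nat \<Rightarrow> (nat \<Rightarrow> int) set" where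
  "int_box d T = vecs d (\<lambda>_. {- int T..int T})"

lemma int_box_iff: "z \<in> int_box d T \<longleftrightarrow> (\<forall>i. \<bar>z i\<bar> \<le> int T) \<and> (\<forall>i\<ge>d. z i = 0)"
proof
  assume z: "z \<in> int_box d T"
  have "\<bar>z i\<bar> \<le> int T" for i
    using z by (cases "i < d") (auto simp: int_box_def vecs_def abs_le_iff not_less)
  then show "(\<forall>i. \<bar>z i\<bar> \<le> int T) \<and> (\<forall>i\<ge>d. z i = 0)"
    using z by (auto simp: int_box_def vecs_def)
qed (auto simp: int_box_def vecs_def abs_le_iff minus_le_iff)

lemma finite_box [simp]: "finite (int_box d T)"
  unfolding int_box_def by (rule finite_vecs) auto

lemma card_box: "card (int_box d T) = (2 * T + 1) ^ d"
  unfolding int_box_def by (simp add: card_vecs nat_add_distrib nat_mult_distrib)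

lemma int_box_add: "x \<in> int_box d a \<Longrightarrow> y \<in> int_box d b \<Longrightarrow> x + y \<in> int_box d (a + b)"
  unfolding int_box_iff by simp (smt (verit))

lemma int_box_mono: "a \<le> b \<Longrightarrow> int_box d a \<subseteq> int_box d b"
  unfolding int_box_iff subset_iff by (meson of_nat_mono order_trans)

lemma int_box_split:
  assumes "z \<in> int_box d (a + b)"
  obtains x y where "x \<in> int_box d a" "y \<in> int_box d b" "z = x + y"
proof
  let ?x = "\<lambda>i. max (- int a) (min (int a) (z i))"
  show "?x \<in> int_box d a"
    using assms by (auto simp: int_box_iff)
  show "z - ?x \<in> int_box d b"
    unfolding int_box_iff
  proof (intro conjI allI impI)
    fix i
    have "\<bar>z i\<bar> \<le> int a + int b" using assms by (simp add: int_box_iff)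
    then show "\<bar>(z - ?x) i\<bar> \<le> int b" by (auto simp: max_def min_def)
  qed (use assms in \<open>auto simp: int_box_iff\<close>)
  show "z = ?x + (z - ?x)" by simp
qed

lemma int_box_subset_intvecs: "int_box d T \<subseteq> intvecs d"
  by (auto simp: int_box_def vecs_def)

lemma intvecs_eq_Union_box:
  assumes "0 < Y" shows "intvecs d = (\<Union>k. int_box d (k * Y))"
proof
  show "intvecs d \<subseteq> (\<Union>k. int_box d (k * Y))"
  proof
    fix z assume z: "z \<in> intvecs d"
    define K where "K = (\<Sum>i<d. nat \<bar>z i\<bar>)"
    have "\<bar>z i\<bar> \<le> int (K * Y)" for i
    proof (cases "i < d")
      case True
      then have "nat \<bar>z i\<bar> \<le> K" unfolding K_def by (intro member_le_sum) auto
      also have "K \<le> K * Y" using assms by simp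
      finally show ?thesis by linarith
    qed (use z in \<open>auto simp: vecs_def\<close>)
    then show "z \<in> (\<Union>k. int_box d (k * Y))"
      using z by (auto simp: int_box_iff vecs_def)
  qed
qed (use int_box_subset_intvecs in blast)

lemma intvecs_add: "x \<in> intvecs d \<Longrightarrow> y \<in> intvecs d \<Longrightarrow> x + y \<in> intvecs d"
  and intvecs_diff: "x \<in> intvecs d \<Longrightarrow> y \<in> intvecs d \<Longrightarrow> x - y \<in> intvecs d"
  by (auto simp: vecs_def)

definition npts :: "nat \<Rightarrow> (nat \<Rightarrow> int) set \<Rightarrow> nat \<Rightarrow> nat" where
  "npts d L T = card (L \<inter> int_box d T)"

section \<open>Classes and lattice points in growing boxes\<close>

text \<open>\<open>f\<close> stands for the quotient map onto Z^d / L, with arbitrary labels for the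
  classes. That \<open>L\<close> is a subgroup follows from \<open>f_eq_iff\<close>.\<close>

locale lattice_quotient =
  fixes d :: nat and L :: "(nat \<Rightarrow> int) set" and f :: "(nat \<Rightarrow> int) \<Rightarrow> 'g"
  assumes L_subset: "L \<subseteq> intvecs d"
    and f_eq_iff: "x \<in> intvecs d \<Longrightarrow> y \<in> intvecs d \<Longrightarrow> f x = f y \<longleftrightarrow> x - y \<in> L"
begin

lemma zero_in_L: "0 \<in> L"
  using f_eq_iff[of 0 0] by (simp add: vecs_def)

lemma L_diff: "x \<in> L \<Longrightarrow> y \<in> L \<Longrightarrow> x - y \<in> L"
proof -
  assume xy: "x \<in> L" "y \<in> L"
  then have V: "x \<in> intvecs d" "y \<in> intvecs d" "0 \<in> intvecs d"
    using L_subset zero_in_L by auto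
  then show ?thesis
    using xy f_eq_iff[of x y] f_eq_iff[of x 0] f_eq_iff[of y 0] by simp
qed

lemma L_add: "x \<in> L \<Longrightarrow> y \<in> L \<Longrightarrow> x + y \<in> L"
  using L_diff[of x "0 - y"] L_diff[OF zero_in_L, of y] by simp

lemma npts_pos: "0 < npts d L T"
proof -
  have "0 \<in> L \<inter> int_box d T" using zero_in_L by (auto simp: int_box_iff)
  then show ?thesis unfolding npts_def by (auto simp: card_gt_0_iff)
qed

lemma f_add_cong:
  assumes "x \<in> intvecs d" "x' \<in> intvecs d" "y \<in> intvecs d"
  shows "f (x + y) = f (x' + y) \<longleftrightarrow> f x = f x'"
  using assms f_eq_iff[of x x'] f_eq_iff[of "x + y" "x' + y"] by (simp add: intvecs_add)

text \<open>Split a point of the next box as \<open>x + y\<close> with \<open>y\<close> of size at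
  most \<open>Y\<close>. By induction \<open>x\<close> may be replaced by a point \<open>x'\<close>
  of the box of radius \<open>k * Y\<close> in the same class, and \<open>x' + y\<close> lies one
  step further, where by assumption no class is new.\<close>

lemma image_box_stable:
  assumes "f ` int_box d (Suc k * Y) = f ` int_box d (k * Y)" and "k \<le> j"
  shows "f ` int_box d (j * Y) = f ` int_box d (k * Y)"
  using assms(2)
proof (induction j rule: dec_induct)
  case (step j)
  show ?case
  proof
    show "f ` int_box d (Suc j * Y) \<subseteq> f ` int_box d (k * Y)"
    proof safe
      fix z assume "z \<in> int_box d (Suc j * Y)"
      then obtain x y where xy: "x \<in> int_box d (j * Y)" "y \<in> int_box d Y" "z = x + y"
        using int_box_split[of z d "j * Y" Y] by (auto simp: add.commute)
      obtain x' where x': "x' \<in> int_box d (k * Y)" "f x = f x'"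
        using xy(1) step.IH by blast
      have "f z = f (x' + y)"
        using xy x' f_add_cong[of x x' y] int_box_subset_intvecs by (meson subsetD)
      moreover have "x' + y \<in> int_box d (Suc k * Y)"
        using int_box_add[OF x'(1) xy(2)] by (simp add: add.commute)
      ultimately show "f z \<in> f ` int_box d (k * Y)" using assms(1) by blast
    qed
    show "f ` int_box d (k * Y) \<subseteq> f ` int_box d (Suc j * Y)"
      using step by (intro image_mono int_box_mono mult_right_mono) auto
  qed
qed simp

text \<open>A step without a new class would, by \<open>image_box_stable\<close>, freeze the set of
  classes for good, although the boxes exhaust Z^d.\<close>

lemma image_box_strict:
  assumes "0 < Y" and "f ` int_box d (k * Y) \<noteq> f ` intvecs d"
  obtains x where "x \<in> int_box d (Suc k * Y)" "f x \<notin> f ` int_box d (k * Y)"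
proof -
  have "\<not> f ` int_box d (Suc k * Y) \<subseteq> f ` int_box d (k * Y)"
  proof
    assume "f ` int_box d (Suc k * Y) \<subseteq> f ` int_box d (k * Y)"
    moreover have "f ` int_box d (k * Y) \<subseteq> f ` int_box d (Suc k * Y)"
      by (intro image_mono int_box_mono) simp
    ultimately have eq: "f ` int_box d (Suc k * Y) = f ` int_box d (k * Y)" by blast
    have "f ` int_box d (j * Y) \<subseteq> f ` int_box d (k * Y)" for j
    proof (cases "k \<le> j")
      case True
      then show ?thesis using image_box_stable[OF eq] by blast
    next
      case False
      then show ?thesis by (intro image_mono int_box_mono) simp
    qed
    then have "f ` intvecs d \<subseteq> f ` int_box d (k * Y)"
      unfolding intvecs_eq_Union_box[OF assms(1), of d] by blast
    then show False using assms(2) int_box_subset_intvecs[of d "k * Y"] by blast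
  qed
  then show ?thesis using that by blast
qed

abbreviation cube :: "nat \<Rightarrow> (nat \<Rightarrow> int) set" where
  "cube Y \<equiv> vecs d (\<lambda>_. {0..int Y})"

lemma cube_subset_box: "cube Y \<subseteq> int_box d Y"
  by (auto simp: vecs_def int_box_def)

lemma cube_diff:
  assumes "p \<in> cube Y" "p' \<in> cube Y" shows "p - p' \<in> int_box d Y"
  unfolding int_box_iff
proof (intro conjI allI impI)
  fix i show "\<bar>(p - p') i\<bar> \<le> int Y"
  proof (cases "i < d")
    case True
    then have "0 \<le> p i" "p i \<le> int Y" "0 \<le> p' i" "p' i \<le> int Y"
      using assms by (auto simp: vecs_def)
    then show ?thesis by simp
  qed (use assms in \<open>auto simp: vecs_def\<close>)
qed (use assms in \<open>auto simp: vecs_def\<close>)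

text \<open>Boxes growing by steps of \<open>2 * Y\<close> keep meeting new classes until all are met; each new class
  contributes a translate of the image of the cube disjoint from the previous ones.\<close>

lemma card_image_box_ge:
  assumes "0 < Y" and "f ` int_box d (2 * J * Y) \<noteq> f ` intvecs d"
  shows "(J + 1) * card (f ` cube Y) \<le> card (f ` int_box d ((2 * J + 2) * Y))"
proof -
  have "\<exists>x. x \<in> int_box d ((2 * j + 1) * Y) \<and> f x \<notin> f ` int_box d (2 * j * Y)" if "j \<le> J" for j
  proof -
    have "f ` int_box d (2 * j * Y) \<subseteq> f ` int_box d (2 * J * Y)"
      using that by (intro image_mono int_box_mono) simp
    then have "f ` int_box d (2 * j * Y) \<noteq> f ` intvecs d"
      using assms(2) int_box_subset_intvecs[of d] by blast
    from image_box_strict[OF assms(1) this] show ?thesis by (metis Suc_eq_plus1)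
  qed
  then obtain x where x: "\<And>j. j \<le> J \<Longrightarrow> x j \<in> int_box d ((2 * j + 1) * Y)"
    and fx: "\<And>j. j \<le> J \<Longrightarrow> f (x j) \<notin> f ` int_box d (2 * j * Y)"
    by metis
  have xV: "x j \<in> intvecs d" if "j \<le> J" for j
    using x[OF that] int_box_subset_intvecs by blast
  have cV: "p \<in> intvecs d" if "p \<in> cube Y" for p
    using that by (auto simp: vecs_def)
  define C where "C j = f ` ((+) (x j) ` cube Y)" for j
  have fin: "finite (cube Y)" by (rule finite_vecs) auto
  have card_C: "card (C j) = card (f ` cube Y)" if "j \<le> J" for j
  proof -
    have "f (x j + p) = f (x j + p') \<longleftrightarrow> f p = f p'" if "p \<in> cube Y" "p' \<in> cube Y" for p p'
      using f_add_cong[of p p' "x j"] cV that xV[OF \<open>j \<le> J\<close>] by (simp add: add.commute)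
    then have "bij_betw (\<lambda>c. f (x j + inv_into (cube Y) f c)) (f ` cube Y) (C j)"
      unfolding C_def bij_betw_def inj_on_def
      by (smt (verit, best) f_inv_into_f image_cong image_iff image_image inv_into_into)
    then show ?thesis by (simp add: bij_betw_same_card)
  qed
  have disj: "C i \<inter> C j = {}" if "i < j" "j \<le> J" for i j
  proof (rule ccontr)
    assume "C i \<inter> C j \<noteq> {}"
    then obtain p p' where pp: "p \<in> cube Y" "p' \<in> cube Y" "f (x i + p) = f (x j + p')"
      unfolding C_def by blast
    \<comment> \<open>A common class would put \<open>f (x j)\<close> among the classes of the box
      of radius \<open>2 * j * Y\<close>: there \<open>x i\<close> costs
      \<open>(2 * i + 1) * Y\<close> and the offset \<open>p - p'\<close> one more \<open>Y\<close>,
      whence steps of \<open>2 * Y\<close>.\<close>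
    have "f (x j) = f (x i + p - p')"
    proof -
      have "x i + p - (x j + p') \<in> L"
        using pp f_eq_iff[of "x i + p" "x j + p'"] that xV[of i] xV[of j] cV by (simp add: intvecs_add)
      then have "f (x i + p - p') = f (x j)"
        using f_eq_iff[of "x i + p - p'" "x j"] that xV[of i] xV[of j] cV pp
        by (simp add: intvecs_add intvecs_diff algebra_simps)
      then show ?thesis by simp
    qed
    moreover have "x i + p - p' \<in> int_box d (2 * j * Y)"
    proof -
      have "x i + (p - p') \<in> int_box d ((2 * i + 1) * Y + Y)"
        using that pp by (intro int_box_add x cube_diff) auto
      moreover have "(2 * i + 1) * Y + Y \<le> 2 * j * Y"
        using mult_right_mono[of "2 * i + 2" "2 * j" Y] that by (simp add: algebra_simps)
      ultimately show ?thesis using int_box_mono by (metis add_diff_eq subsetD)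
    qed
    ultimately show False using fx[OF \<open>j \<le> J\<close>] by (metis image_eqI)
  qed
  have "(J + 1) * card (f ` cube Y) = (\<Sum>j\<in>{..J}. card (C j))"
    by (simp add: card_C)
  also have "\<dots> = card (\<Union>j\<in>{..J}. C j)"
  proof (rule card_UN_disjoint[symmetric])
    show "\<forall>i\<in>{..J}. finite (C i)" unfolding C_def using fin by blast
    show "\<forall>i\<in>{..J}. \<forall>j\<in>{..J}. i \<noteq> j \<longrightarrow> C i \<inter> C j = {}"
      using disj by (metis Int_commute atMost_iff linorder_neqE_nat)
  qed simp
  also have "\<dots> \<le> card (f ` int_box d ((2 * J + 2) * Y))"
  proof (rule card_mono)
    show "(\<Union>j\<in>{..J}. C j) \<subseteq> f ` int_box d ((2 * J + 2) * Y)"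
    proof safe
      fix j c assume "j \<le> J" "c \<in> C j"
      then obtain p where p: "p \<in> cube Y" "c = f (x j + p)" unfolding C_def by blast
      have "x j + p \<in> int_box d ((2 * j + 1) * Y + Y)"
        using int_box_add[OF x[OF \<open>j \<le> J\<close>]] p cube_subset_box by blast
      moreover have "(2 * j + 1) * Y + Y \<le> (2 * J + 2) * Y"
        using mult_right_mono[of "2 * j + 2" "2 * J + 2" Y] \<open>j \<le> J\<close> by (simp add: algebra_simps)
      ultimately show "c \<in> f ` int_box d ((2 * J + 2) * Y)"
        using p int_box_mono by blast
    qed
  qed simp
  finally show ?thesis .
qed

text \<open>Pigeonhole: two points of the cube in one class differ by a lattice point of the box of
  radius \<open>Y\<close>, so no class holds more than \<open>npts d L Y\<close> of them. The
  one-sided cube keeps the difference within \<open>Y\<close> instead of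
  \<open>2 * Y\<close>.\<close>

lemma card_image_cube_ge: "(Y + 1) ^ d \<le> card (f ` cube Y) * npts d L Y"
proof -
  have fin: "finite (cube Y)" by (rule finite_vecs) auto
  have "card (cube Y) \<le> card (f ` cube Y) * npts d L Y"
  proof (rule card_le_fibres[OF fin])
    fix y assume "y \<in> f ` cube Y"
    then obtain p where p: "p \<in> cube Y" "y = f p" by blast
    have "(\<lambda>x. x - p) ` {x \<in> cube Y. f x = y} \<subseteq> L \<inter> int_box d Y"
    proof safe
      fix x assume x: "x \<in> cube Y" "y = f x"
      then show "x - p \<in> L" using p f_eq_iff[of x p] by (auto simp: vecs_def)
      show "x - p \<in> int_box d Y"
        using x p by (blast intro: cube_diff)
    qed
    then have "card ((\<lambda>x. x - p) ` {x \<in> cube Y. f x = y}) \<le> npts d L Y"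
      unfolding npts_def by (intro card_mono) auto
    then show "card {x \<in> cube Y. f x = y} \<le> npts d L Y"
      by (subst (asm) card_image) (auto simp: inj_on_def)
  qed
  moreover have "card {0..int Y} = Y + 1" by simp
  ultimately show ?thesis by (simp only: card_vecs prod_constant card_lessThan)
qed

text \<open>The counterpart of the pigeonhole bound, by packing: one representative for each class
  met by the box of radius \<open>a\<close>, shifted by the lattice points of the box of radius
  \<open>b\<close>, gives pairwise distinct points of the box of radius
  \<open>a + b\<close>.\<close>

lemma card_image_box_le: "card (f ` int_box d a) * npts d L b \<le> (2 * (a + b) + 1) ^ d"
proof -
  define g where "g = (\<lambda>(c, z). inv_into (int_box d a) f c + z)"
  have inv: "inv_into (int_box d a) f c \<in> int_box d a" "f (inv_into (int_box d a) f c) = c"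
    if "c \<in> f ` int_box d a" for c
    using that by (auto simp: inv_into_into f_inv_into_f)
  have f_g: "f (g (c, z)) = c" if "c \<in> f ` int_box d a" "z \<in> L" for c z
  proof -
    have "inv_into (int_box d a) f c \<in> intvecs d" using inv[OF that(1)] int_box_subset_intvecs by blast
    moreover have "z \<in> intvecs d" using that L_subset by blast
    ultimately have "f (inv_into (int_box d a) f c + z) = f (inv_into (int_box d a) f c)"
      using f_eq_iff[of "inv_into (int_box d a) f c + z" "inv_into (int_box d a) f c"] that
      by (simp add: intvecs_add)
    then show ?thesis using inv[OF that(1)] by (simp add: g_def)
  qed
  have "inj_on g (f ` int_box d a \<times> (L \<inter> int_box d b))"
  proof (rule inj_onI, clarify)
    fix c z c' z'
    assume "c \<in> int_box d a" "c' \<in> int_box d a" and z: "z \<in> L" "z' \<in> L" and eq: "g (f c, z) = g (f c', z')"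
    then have "f c = f c'" using f_g[of "f c" z] f_g[of "f c'" z'] by simp
    then show "f c = f c' \<and> z = z'" using eq by (simp add: g_def)
  qed
  moreover have "g ` (f ` int_box d a \<times> (L \<inter> int_box d b)) \<subseteq> int_box d (a + b)"
    using inv(1) by (auto simp: g_def intro!: int_box_add)
  ultimately have "card (f ` int_box d a \<times> (L \<inter> int_box d b)) \<le> card (int_box d (a + b))"
    by (meson card_inj_on_le finite_box)
  then show ?thesis by (simp add: card_cartesian_product npts_def card_box)
qed

text \<open>Let \<open>v\<close> have the largest supremum norm among the nonzero lattice points of
  the box, attained at \<open>i0\<close>. Two such points differ by at most
  \<open>2 * \<bar>v i0\<bar>\<close> at \<open>i0\<close>, so the translates of their set by
  distinct multiples of \<open>3 * v\<close> are disjoint. This linear growth serves to bound small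
  boxes by larger ones.\<close>

lemma multiple_npts_le:
  "a * card (L \<inter> int_box d T - {0}) \<le> npts d L (3 * a * T)"
proof (cases "L \<inter> int_box d T - {0} = {} \<or> a = 0")
  case False
  define S where "S = L \<inter> int_box d T - {0}"
  define nrm where "nrm z = Max ((\<lambda>i. \<bar>z i\<bar>) ` {..<d})" for z :: "nat \<Rightarrow> int"
  have fin: "finite S" by (simp add: S_def)
  have "S \<noteq> {}" using False by (simp add: S_def)
  then obtain v where v: "v \<in> S" and vmax: "\<And>x. x \<in> S \<Longrightarrow> nrm x \<le> nrm v"
    using obtains_MAX[OF fin] by (metis Max_ge finite_imageI fin imageI)
  have d: "0 < d"
  proof (rule ccontr)
    assume "\<not> 0 < d"
    then have "v = 0" using v by (auto simp: S_def int_box_iff fun_eq_iff)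
    then show False using v by (simp add: S_def)
  qed
  have "nrm v \<in> (\<lambda>i. \<bar>v i\<bar>) ` {..<d}"
    unfolding nrm_def using d by (intro Max_in) auto
  then obtain i0 where i0: "i0 < d" "nrm v = \<bar>v i0\<bar>" by auto
  have le: "\<bar>x i\<bar> \<le> \<bar>v i0\<bar>" if "x \<in> S" for x i
  proof (cases "i < d")
    case True
    then have "\<bar>x i\<bar> \<le> nrm x" unfolding nrm_def by (intro Max_ge) auto
    then show ?thesis using vmax[OF that] i0 by simp
  qed (use that in \<open>auto simp: S_def int_box_iff\<close>)
  have v0: "v i0 \<noteq> 0"
  proof
    assume "v i0 = 0"
    then have "v = 0" using le[OF v] by (auto simp: fun_eq_iff)
    then show False using v by (simp add: S_def)
  qed
  define g where "g = (\<lambda>(j::nat, x) i. x i + 3 * int j * v i)"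
  have mult: "(\<lambda>i. int j * v i) \<in> L" for j
  proof (induction j)
    case 0
    then show ?case using zero_in_L by (simp add: zero_fun_def)
  next
    case (Suc j)
    have "(\<lambda>i. int j * v i) + v \<in> L" using Suc v by (intro L_add) (auto simp: S_def)
    then show ?case by (simp add: plus_fun_def algebra_simps)
  qed
  have "inj_on g ({..<a} \<times> S)"
  proof (rule inj_onI, clarify)
    fix j x j' x' assume x: "x \<in> S" "x' \<in> S" and eq: "g (j, x) = g (j', x')"
    have eqi: "x i + 3 * int j * v i = x' i + 3 * int j' * v i" for i
      using fun_cong[OF eq, of i] by (simp add: g_def)
    have "j = j'"
    proof (rule ccontr)
      assume "j \<noteq> j'"
      have "3 * (int j - int j') * v i0 = x' i0 - x i0"
        using eqi[of i0] by (simp add: algebra_simps)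
      then have "3 * \<bar>int j - int j'\<bar> * \<bar>v i0\<bar> = \<bar>x' i0 - x i0\<bar>"
        by (metis abs_mult abs_numeral)
      also have "\<dots> \<le> 2 * \<bar>v i0\<bar>" using le[OF x(1), of i0] le[OF x(2), of i0] by linarith
      finally have "3 * \<bar>int j - int j'\<bar> \<le> 2" using v0 by simp
      then show False using \<open>j \<noteq> j'\<close> by presburger
    qed
    then show "j = j' \<and> x = x'" using eqi by (auto simp: fun_eq_iff)
  qed
  moreover have "g ` ({..<a} \<times> S) \<subseteq> L \<inter> int_box d (3 * a * T)"
  proof (rule image_subsetI, clarify)
    fix j x assume j: "j < a" and x: "x \<in> S"
    have "x + (\<lambda>i. int (3 * j) * v i) \<in> L" using x by (intro L_add mult) (simp add: S_def)
    then have "g (j, x) \<in> L" by (simp add: g_def plus_fun_def)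
    moreover have "g (j, x) \<in> int_box d (3 * a * T)"
      unfolding int_box_iff
    proof (intro conjI allI impI)
      fix i
      have "\<bar>x i\<bar> \<le> int T" "\<bar>v i\<bar> \<le> int T" using x v by (auto simp: S_def int_box_iff)
      then have "\<bar>x i + 3 * int j * v i\<bar> \<le> int T + 3 * int j * int T"
        by (intro order_trans[OF abs_triangle_ineq] add_mono) (auto simp: abs_mult mult_left_mono)
      also have "\<dots> \<le> 3 * int a * int T"
        using mult_right_mono[of "1 + 3 * int j" "3 * int a" "int T"] j by (simp add: algebra_simps)
      finally show "\<bar>g (j, x) i\<bar> \<le> int (3 * a * T)" by (simp add: g_def)
    next
      fix i assume "d \<le> i" then show "g (j, x) i = 0"
        using x v by (auto simp: g_def S_def int_box_iff)
    qed
    ultimately show "g (j, x) \<in> L \<inter> int_box d (3 * a * T)" by simp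
  qed
  ultimately have "card ({..<a} \<times> S) \<le> npts d L (3 * a * T)"
    unfolding npts_def by (intro card_inj_on_le[of g]) auto
  then show ?thesis by (simp add: card_cartesian_product S_def)
next
  case True
  then have "a * card (L \<inter> int_box d T - {0}) = 0" by (metis card.empty mult_0 mult_0_right)
  then show ?thesis by linarith
qed

end

text \<open>Writing the index as \<open>Y ^ d\<close> makes \<open>Y\<close> the natural scale: a
  box of radius \<open>Y\<close> has volume comparable to the covolume of \<open>L\<close>.\<close>

locale finite_lattice_quotient = lattice_quotient +
  fixes Y :: nat
  assumes Y_pos: "0 < Y" and index: "card (f ` intvecs d) = Y ^ d"
begin

lemma finite_range: "finite (f ` intvecs d)"
  using index Y_pos by (metis card.infinite power_not_zero not_gr_zero)

text \<open>Few lattice points force a small covering radius. By pigeonhole the cube meets at least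
  \<open>(Y + 1) ^ d / H\<close> classes; if the box missed a class, a slightly larger box would
  contain \<open>H + 1\<close> disjoint copies of that image, more than the \<open>Y ^ d\<close>
  classes there are.\<close>

lemma image_box_eq:
  assumes "npts d L Y \<le> H"
  shows "f ` int_box d (2 * H * Y) = f ` intvecs d"
proof (rule ccontr)
  assume neq: "f ` int_box d (2 * H * Y) \<noteq> f ` intvecs d"
  have "(H + 1) * card (f ` cube Y) \<le> card (f ` int_box d ((2 * H + 2) * Y))"
    by (rule card_image_box_ge[OF Y_pos neq])
  also have "\<dots> \<le> Y ^ d"
    unfolding index[symmetric] using finite_range int_box_subset_intvecs by (intro card_mono) auto
  finally have *: "(H + 1) * card (f ` cube Y) \<le> Y ^ d" .
  have "card (f ` cube Y) * npts d L Y \<le> card (f ` cube Y) * H" using assms by simp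
  moreover have "Y ^ d \<le> (Y + 1) ^ d" by (intro power_mono) auto
  ultimately have "(H + 1) * card (f ` cube Y) \<le> card (f ` cube Y) * H"
    using * card_image_cube_ge[of Y] by linarith
  then have "card (f ` cube Y) = 0" by simp
  then show False using card_image_cube_ge[of Y] by simp
qed

text \<open>Either the box of radius \<open>2 * (s - 1) * Y\<close> meets all classes, and packing
  bounds the count by a multiple of \<open>s ^ d\<close>; or it misses one, \<open>s\<close>
  disjoint copies of the cube image fit into the box of radius \<open>2 * s * Y\<close>, and packing
  gains a factor \<open>s\<close>. Hence the power \<open>s ^ (d - 1)\<close> in front of
  \<open>npts d L Y\<close>. The 7 is \<open>2 * (2 + 1) + 1\<close>.\<close>

lemma npts_mult_le:
  assumes "1 \<le> s" "1 \<le> d"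
  shows "npts d L (s * Y) \<le> 7 ^ d * (s ^ (d - 1) * npts d L Y + s ^ d)"
proof -
  have s7: "2 * ((2 * s + s) * Y) + 1 \<le> 7 * s * Y"
    using assms Y_pos by (simp add: algebra_simps Suc_leI)
  show ?thesis
  proof (cases "f ` int_box d (2 * (s - 1) * Y) = f ` intvecs d")
    case True
    have "Y ^ d * npts d L (s * Y) \<le> (2 * (2 * (s - 1) * Y + s * Y) + 1) ^ d"
      using card_image_box_le[of "2 * (s - 1) * Y" "s * Y"] True index by simp
    also have "\<dots> \<le> (7 * s * Y) ^ d"
    proof (rule power_mono)
      have "2 * (s - 1) * Y + s * Y \<le> (2 * s + s) * Y"
        unfolding distrib_right[symmetric] by (intro mult_right_mono) auto
      then show "2 * (2 * (s - 1) * Y + s * Y) + 1 \<le> 7 * s * Y"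
        by (intro order_trans[OF _ s7] add_right_mono mult_left_mono) auto
    qed simp
    also have "\<dots> = Y ^ d * (7 ^ d * s ^ d)" by (simp add: power_mult_distrib)
    finally have "npts d L (s * Y) \<le> 7 ^ d * s ^ d" using Y_pos by simp
    then show ?thesis by (simp add: algebra_simps)
  next
    case False
    have sJ: "2 * (s - 1) + 2 = 2 * s" using assms by simp
    have "s * card (f ` cube Y) * npts d L (s * Y) \<le> card (f ` int_box d (2 * s * Y)) * npts d L (s * Y)"
      using card_image_box_ge[OF Y_pos False] assms unfolding sJ by (intro mult_right_mono) auto
    also have "\<dots> \<le> (2 * (2 * s * Y + s * Y) + 1) ^ d" by (rule card_image_box_le)
    also have "\<dots> \<le> (7 * s * (Y + 1)) ^ d"
      using s7 by (intro power_mono) (auto simp: algebra_simps)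
    also have "\<dots> = 7 ^ d * s ^ d * (Y + 1) ^ d" by (simp only: power_mult_distrib)
    also have "\<dots> \<le> 7 ^ d * s ^ d * (card (f ` cube Y) * npts d L Y)"
      by (intro mult_left_mono card_image_cube_ge) auto
    also have "s ^ d = s * s ^ (d - 1)" using assms by (simp add: power_eq_if)
    finally have "(s * card (f ` cube Y)) * npts d L (s * Y)
        \<le> (s * card (f ` cube Y)) * (7 ^ d * (s ^ (d - 1) * npts d L Y))"
      by (simp add: ac_simps)
    moreover have "card (f ` cube Y) \<noteq> 0" using card_image_cube_ge[of Y] by (metis add_is_0 le_zero_eq mult_0 power_not_zero zero_neq_one)
    ultimately have "npts d L (s * Y) \<le> 7 ^ d * (s ^ (d - 1) * npts d L Y)" using assms by simp
    then show ?thesis by (simp add: algebra_simps)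
  qed
qed

end

section \<open>The lattice of a matrix and the average over subcubes\<close>

definition form_residue :: "nat \<Rightarrow> nat \<Rightarrow> (nat \<Rightarrow> nat \<Rightarrow> int) \<Rightarrow> (nat \<Rightarrow> int) \<Rightarrow> nat \<Rightarrow> int" where
  "form_residue m n A z i = z i - (\<Sum>j<n. A i j * z (m + j))"

definition form_lattice :: "nat \<Rightarrow> nat \<Rightarrow> nat \<Rightarrow> (nat \<Rightarrow> nat \<Rightarrow> int) \<Rightarrow> (nat \<Rightarrow> int) set" where
  "form_lattice m n M A = {z \<in> intvecs (m + n). \<forall>i<m. int M dvd form_residue m n A z i}"

definition form_class :: "nat \<Rightarrow> nat \<Rightarrow> nat \<Rightarrow> (nat \<Rightarrow> nat \<Rightarrow> int) \<Rightarrow> (nat \<Rightarrow> int) \<Rightarrow> nat \<Rightarrow> int" where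
  "form_class m n M A z = (\<lambda>i. if i < m then form_residue m n A z i mod int M else 0)"

lemma form_residue_diff: "form_residue m n A (x - y) i = form_residue m n A x i - form_residue m n A y i"
  by (simp add: form_residue_def sum_subtractf right_diff_distrib)

lemma form_class_eq_iff:
  assumes "x \<in> intvecs (m + n)" "y \<in> intvecs (m + n)"
  shows "form_class m n M A x = form_class m n M A y \<longleftrightarrow> x - y \<in> form_lattice m n M A"
  using intvecs_diff[OF assms]
  by (auto simp: form_class_def form_lattice_def fun_eq_iff form_residue_diff mod_eq_dvd_iff)

text \<open>A vector with vanishing \<open>q\<close> part and other entries in
  \<open>{0..<int M}\<close> is its own class, so every residue vector occurs and the lattice has
  index \<open>M ^ m\<close>.\<close>

lemma form_class_image:
  assumes "0 < M"
  shows "form_class m n M A ` intvecs (m + n) = vecs m (\<lambda>_. {0..<int M})"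
proof
  show "form_class m n M A ` intvecs (m + n) \<subseteq> vecs m (\<lambda>_. {0..<int M})"
    using assms by (auto simp: form_class_def vecs_def)
  show "vecs m (\<lambda>_. {0..<int M}) \<subseteq> form_class m n M A ` intvecs (m + n)"
  proof
    fix z assume z: "z \<in> vecs m (\<lambda>_. {0..<int M})"
    then have "form_class m n M A z = z" "z \<in> intvecs (m + n)"
      by (auto simp: form_class_def form_residue_def vecs_def fun_eq_iff)
    then show "z \<in> form_class m n M A ` intvecs (m + n)" by (metis image_eqI)
  qed
qed

lemma finite_lattice_quotient_form:
  assumes "0 < M" "0 < Y" "M ^ m = Y ^ (m + n)"
  shows "finite_lattice_quotient (m + n) (form_lattice m n M A) (form_class m n M A) Y"
proof
  show "card (form_class m n M A ` intvecs (m + n)) = Y ^ (m + n)"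
    unfolding form_class_image[OF assms(1)] using assms by (simp add: card_vecs)
qed (use assms form_class_eq_iff in \<open>auto simp: form_lattice_def\<close>)

section \<open>Counting the matrices that keep a given vector short\<close>

lemma card_int_affine_le:
  fixes a b :: int
  assumes "b \<noteq> 0"
  shows "finite {x. \<bar>a + x * b\<bar> \<le> int W}"
    and "real (card {x. \<bar>a + x * b\<bar> \<le> int W}) \<le> 2 * real W / \<bar>real_of_int b\<bar> + 1"
proof -
  define c where "c = - real_of_int a / real_of_int b"
  define h where "h = real W / \<bar>real_of_int b\<bar>"
  have "{x. \<bar>a + x * b\<bar> \<le> int W} \<subseteq> {\<lceil>c - h\<rceil>..\<lfloor>c + h\<rfloor>}"
  proof safe
    fix x assume "\<bar>a + x * b\<bar> \<le> int W"
    then have "\<bar>real_of_int a + real_of_int x * real_of_int b\<bar> \<le> real W"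
      by (metis of_int_abs of_int_add of_int_le_iff of_int_mult of_int_of_nat_eq)
    moreover have "real_of_int a + real_of_int x * real_of_int b = (real_of_int x - c) * real_of_int b"
      using assms by (simp add: c_def field_simps)
    ultimately have "\<bar>real_of_int x - c\<bar> * \<bar>real_of_int b\<bar> \<le> real W"
      by (simp only: abs_mult)
    then have "\<bar>real_of_int x - c\<bar> \<le> h"
      using assms by (simp add: h_def pos_le_divide_eq)
    then show "x \<in> {\<lceil>c - h\<rceil>..\<lfloor>c + h\<rfloor>}" by (simp add: ceiling_le_iff le_floor_iff) linarith
  qed
  note sub = this
  show "finite {x. \<bar>a + x * b\<bar> \<le> int W}" using sub by (rule finite_subset) simp
  have "card {x. \<bar>a + x * b\<bar> \<le> int W} \<le> nat (\<lfloor>c + h\<rfloor> - \<lceil>c - h\<rceil> + 1)"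
    using card_mono[OF _ sub] by simp
  moreover have "0 \<le> h" by (simp add: h_def)
  then have "real (nat (\<lfloor>c + h\<rfloor> - \<lceil>c - h\<rceil> + 1)) \<le> 2 * h + 1" by linarith
  ultimately show "real (card {x. \<bar>a + x * b\<bar> \<le> int W}) \<le> 2 * real W / \<bar>real_of_int b\<bar> + 1"
    unfolding h_def by simp
qed

text \<open>With all entries other than \<open>e j0\<close> fixed, the condition confines
  \<open>e j0\<close> to an interval of length \<open>2 * W / \<bar>q j0\<bar>\<close>. Erasing that
  entry is the projection \<open>f\<close> whose fibres are counted.\<close>

lemma card_row_le:
  fixes q :: "nat \<Rightarrow> int"
  assumes "j0 < n" "q j0 \<noteq> 0"
  shows "real (card {e \<in> vecs n (\<lambda>_. {0..<int R}). \<bar>w + (\<Sum>j<n. e j * q j)\<bar> \<le> int W})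
    \<le> real R ^ (n - 1) * (2 * real W / \<bar>real_of_int (q j0)\<bar> + 1)"
proof -
  define S where "S = {e \<in> vecs n (\<lambda>_. {0..<int R}). \<bar>w + (\<Sum>j<n. e j * q j)\<bar> \<le> int W}"
  define f where "f e = e(j0 := 0)" for e :: "nat \<Rightarrow> int"
  define k where "k = nat \<lfloor>2 * real W / \<bar>real_of_int (q j0)\<bar> + 1\<rfloor>"
  have "finite (vecs n (\<lambda>_. {0..<int R}))" by (rule finite_vecs) auto
  then have fin: "finite S" by (simp add: S_def)
  have "card S \<le> card (f ` S) * k"
  proof (rule card_le_fibres[OF fin])
    fix y assume "y \<in> f ` S"
    define a where "a = w + (\<Sum>j\<in>{..<n} - {j0}. y j * q j)"
    have "(\<lambda>e. e j0) ` {e \<in> S. f e = y} \<subseteq> {x. \<bar>a + x * q j0\<bar> \<le> int W}"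
    proof safe
      fix e assume e: "e \<in> S" "y = f e"
      have "(\<Sum>j<n. e j * q j) = e j0 * q j0 + (\<Sum>j\<in>{..<n} - {j0}. e j * q j)"
        using assms(1) by (simp add: sum.remove)
      also have "(\<Sum>j\<in>{..<n} - {j0}. e j * q j) = (\<Sum>j\<in>{..<n} - {j0}. y j * q j)"
        using e by (intro sum.cong) (auto simp: f_def)
      finally show "\<bar>a + e j0 * q j0\<bar> \<le> int W"
        using e by (simp add: S_def a_def algebra_simps)
    qed
    then have "card ((\<lambda>e. e j0) ` {e \<in> S. f e = y}) \<le> card {x. \<bar>a + x * q j0\<bar> \<le> int W}"
      by (intro card_mono card_int_affine_le assms)
    moreover have "card {x. \<bar>a + x * q j0\<bar> \<le> int W} \<le> k"
      unfolding k_def using card_int_affine_le(2)[OF assms(2), of a W] by (rule le_nat_floor)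
    moreover have "inj_on (\<lambda>e. e j0) {e \<in> S. f e = y}"
    proof (rule inj_onI)
      fix e e' assume e: "e \<in> {e \<in> S. f e = y}" "e' \<in> {e \<in> S. f e = y}" "e j0 = e' j0"
      then have "(f e)(j0 := e j0) = (f e')(j0 := e' j0)" by simp
      then show "e = e'" by (simp add: f_def)
    qed
    ultimately show "card {e \<in> S. f e = y} \<le> k" by (simp add: card_image)
  qed
  also have "card (f ` S) \<le> R ^ (n - 1)"
  proof -
    have "f ` S \<subseteq> vecs n (\<lambda>j. if j = j0 then {0} else {0..<int R})"
      by (auto simp: f_def S_def vecs_def)
    then have "card (f ` S) \<le> card (vecs n (\<lambda>j. if j = j0 then {0} else {0..<int R}))"
      by (intro card_mono finite_vecs) auto
    also have "\<dots> = (\<Prod>j\<in>{..<n} - {j0}. R)"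
      unfolding card_vecs using assms(1) by (subst prod.remove[of _ j0]) (auto intro!: prod.cong)
    finally show ?thesis using assms(1) by simp
  qed
  finally have "card S \<le> R ^ (n - 1) * k" by simp
  then have "real (card S) \<le> real R ^ (n - 1) * real k" by (metis of_nat_le_iff of_nat_mult of_nat_power)
  also have "\<dots> \<le> real R ^ (n - 1) * (2 * real W / \<bar>real_of_int (q j0)\<bar> + 1)"
    unfolding k_def by (intro mult_left_mono of_nat_floor) auto
  finally show ?thesis by (simp add: S_def)
qed

abbreviation intmats :: "nat \<Rightarrow> nat \<Rightarrow> nat \<Rightarrow> (nat \<Rightarrow> nat \<Rightarrow> int) set" where
  "intmats m n R \<equiv> vecs m (\<lambda>_. vecs n (\<lambda>_. {0..<int R}))"

lemma finite_intmats: "finite (intmats m n R)"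
  by (intro finite_vecs) auto

lemma card_intmats: "card (intmats m n R) = R ^ (m * n)"
  by (simp add: card_vecs power_mult[symmetric] mult.commute)

text \<open>The rows of a random matrix move independently, and moving the entry opposite to the
  largest \<open>q j0\<close> already makes each row condition unlikely.\<close>

lemma card_intmats_le:
  fixes q u :: "nat \<Rightarrow> int"
  assumes "j0 < n" "q j0 \<noteq> 0" "\<bar>q j0\<bar> \<le> int (R * Z)"
  shows "real (card {E \<in> intmats m n R. \<forall>i<m. \<bar>int R * u i + (\<Sum>j<n. E i j * q j)\<bar> \<le> int (R * Z)})
    \<le> real R ^ (m * n) * min 1 (3 * real Z / \<bar>real_of_int (q j0)\<bar>) ^ m"
proof -
  define row where "row i = {e \<in> vecs n (\<lambda>_. {0..<int R}).
      \<bar>int R * u i + (\<Sum>j<n. e j * q j)\<bar> \<le> int (R * Z)}" for i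
  have fin: "finite (vecs n (\<lambda>_. {0..<int R}))" by (rule finite_vecs) auto
  have R: "real R ^ n = real R ^ (n - 1) * real R"
    using assms(1) by (simp add: power_eq_if)
  have row_le: "real (card (row i)) \<le> real R ^ n * min 1 (3 * real Z / \<bar>real_of_int (q j0)\<bar>)" for i
  proof -
    have "card (row i) \<le> card (vecs n (\<lambda>_. {0..<int R}))"
      unfolding row_def by (intro card_mono fin) auto
    then have 1: "real (card (row i)) \<le> real R ^ n" by (simp add: card_vecs)
    have "real (card (row i)) \<le> real R ^ (n - 1) * (2 * real (R * Z) / \<bar>real_of_int (q j0)\<bar> + 1)"
      unfolding row_def by (rule card_row_le[of j0 n q R "int R * u i" "R * Z"]) (use assms in auto)
    also have "\<dots> \<le> real R ^ (n - 1) * (real R * (3 * real Z / \<bar>real_of_int (q j0)\<bar>))"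
    proof (rule mult_left_mono)
      \<comment> \<open>The upper bound on \<open>q j0\<close> absorbs the \<open>+ 1\<close> of the
        row count, which turns the 2 into a 3.\<close>
      have "\<bar>real_of_int (q j0)\<bar> \<le> real (R * Z)" using assms(3)
        by (metis of_int_abs of_int_le_iff of_int_of_nat_eq)
      then have "2 * real (R * Z) / \<bar>real_of_int (q j0)\<bar> + \<bar>real_of_int (q j0)\<bar> / \<bar>real_of_int (q j0)\<bar>
          \<le> 2 * real (R * Z) / \<bar>real_of_int (q j0)\<bar> + real (R * Z) / \<bar>real_of_int (q j0)\<bar>"
        by (intro add_left_mono divide_right_mono) auto
      also have "\<dots> = real R * (3 * real Z / \<bar>real_of_int (q j0)\<bar>)"
        by (simp add: add_divide_distrib[symmetric])
      finally show "2 * real (R * Z) / \<bar>real_of_int (q j0)\<bar> + 1 \<le> real R * (3 * real Z / \<bar>real_of_int (q j0)\<bar>)"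
        using assms(2) by simp
    qed simp
    finally show ?thesis using 1 by (simp add: R min_def)
  qed
  have "{E \<in> intmats m n R. \<forall>i<m. \<bar>int R * u i + (\<Sum>j<n. E i j * q j)\<bar> \<le> int (R * Z)} = vecs m row"
    by (auto simp: row_def vecs_def)
  then have "real (card {E \<in> intmats m n R. \<forall>i<m. \<bar>int R * u i + (\<Sum>j<n. E i j * q j)\<bar> \<le> int (R * Z)})
      = (\<Prod>i<m. real (card (row i)))"
    by (simp add: card_vecs)
  also have "\<dots> \<le> (\<Prod>i<m. real R ^ n * min 1 (3 * real Z / \<bar>real_of_int (q j0)\<bar>))"
    by (intro prod_mono) (auto simp: row_le)
  also have "\<dots> = real R ^ (m * n) * min 1 (3 * real Z / \<bar>real_of_int (q j0)\<bar>) ^ m"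
    by (simp add: power_mult_distrib power_mult[symmetric] mult.commute)
  finally show ?thesis .
qed

section \<open>Subcubes and the average of the height\<close>

definition child :: "nat \<Rightarrow> (nat \<Rightarrow> nat \<Rightarrow> int) \<Rightarrow> (nat \<Rightarrow> nat \<Rightarrow> int) \<Rightarrow> nat \<Rightarrow> nat \<Rightarrow> int" where
  "child R A E = (\<lambda>i j. int R * A i j + E i j)"

text \<open>For a parent vector \<open>z = (u, q)\<close>, the vector of the child lattice over it
  is \<open>(R * u + E q, q)\<close>; the predicate says that this vector lies in the box of radius
  \<open>R * Z\<close>.\<close>

definition meets :: "nat \<Rightarrow> nat \<Rightarrow> nat \<Rightarrow> nat \<Rightarrow> (nat \<Rightarrow> int) \<Rightarrow> (nat \<Rightarrow> nat \<Rightarrow> int) \<Rightarrow> bool" where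
  "meets m n R Z z E \<longleftrightarrow> (\<forall>j<n. \<bar>z (m + j)\<bar> \<le> int (R * Z)) \<and>
     (\<forall>i<m. \<bar>int R * z i + (\<Sum>j<n. E i j * z (m + j))\<bar> \<le> int (R * Z))"

text \<open>The entries of \<open>E\<close> are below \<open>R\<close>, so recovering
  \<open>u\<close> from \<open>R * u + E q\<close> costs only \<open>Z + n * Q\<close>: a parent
  vector whose child is short is controlled by its \<open>q\<close> part.\<close>

lemma meets_bound:
  assumes "meets m n R Z z E" "E \<in> intmats m n R" "0 < R" "\<And>j. j < n \<Longrightarrow> \<bar>z (m + j)\<bar> \<le> int Q"
    and "z \<in> intvecs (m + n)"
  shows "z \<in> int_box (m + n) (n * Q + Q + Z)"
  unfolding int_box_iff
proof (intro conjI allI impI)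
  fix i
  consider "i < m" | "m \<le> i" "i < m + n" | "m + n \<le> i" by linarith
  then show "\<bar>z i\<bar> \<le> int (n * Q + Q + Z)"
  proof cases
    case 1
    have "\<bar>\<Sum>j<n. E i j * z (m + j)\<bar> \<le> (\<Sum>j<n. int R * int Q)"
    proof (rule order_trans[OF sum_abs sum_mono])
      fix j assume j: "j \<in> {..<n}"
      then have "0 \<le> E i j \<and> E i j < int R" using assms(2) 1 by (auto simp: vecs_def)
      then show "\<bar>E i j * z (m + j)\<bar> \<le> int R * int Q"
        using assms(4) j by (auto simp: abs_mult intro!: mult_mono)
    qed
    moreover have "\<bar>int R * z i + (\<Sum>j<n. E i j * z (m + j))\<bar> \<le> int R * int Z"
      using assms(1) 1 by (simp add: meets_def)
    ultimately have "\<bar>int R * z i\<bar> \<le> int R * int Z + int n * (int R * int Q)" by simp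
    then have "int R * \<bar>z i\<bar> \<le> int R * (int Z + int n * int Q)" by (simp add: abs_mult algebra_simps)
    then have "\<bar>z i\<bar> \<le> int Z + int n * int Q" using assms(3) by simp
    then show ?thesis by simp
  next
    case 2
    then have "\<bar>z (m + (i - m))\<bar> \<le> int Q" by (intro assms(4)) linarith
    moreover have "int Q \<le> int (n * Q + Q + Z)" by (intro of_nat_mono) simp
    ultimately show ?thesis using 2 by (simp only: le_add_diff_inverse)
  next
    case 3 then show ?thesis using assms(5) by (simp add: vecs_def)
  qed
qed (use assms(5) in \<open>auto simp: vecs_def\<close>)

lemma npts_child_le:
  assumes "0 < R" "E \<in> intmats m n R"
  shows "npts (m + n) (form_lattice m n (R * M) (child R A E)) (R * Z)
    \<le> card {z \<in> form_lattice m n M A \<inter> int_box (m + n) ((n + 2) * (R * Z)). meets m n R Z z E}"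
proof -
  define g where "g z = (\<lambda>i. if i < m then int R * z i + (\<Sum>j<n. E i j * z (m + j)) else z i)"
    for z :: "nat \<Rightarrow> int"
  define S where "S = {z \<in> form_lattice m n M A \<inter> int_box (m + n) ((n + 2) * (R * Z)). meets m n R Z z E}"
  have "form_lattice m n (R * M) (child R A E) \<inter> int_box (m + n) (R * Z) \<subseteq> g ` S"
  proof
    fix x assume x: "x \<in> form_lattice m n (R * M) (child R A E) \<inter> int_box (m + n) (R * Z)"
    then have xV: "x \<in> intvecs (m + n)" and xb: "\<And>i. \<bar>x i\<bar> \<le> int (R * Z)"
      by (auto simp: form_lattice_def int_box_iff)
    have "\<exists>c. i < m \<longrightarrow> x i - (\<Sum>j<n. (int R * A i j + E i j) * x (m + j)) = int (R * M) * c" for i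
      using x by (auto simp: form_lattice_def form_residue_def child_def dvd_def)
    then obtain c where c: "\<And>i. i < m \<Longrightarrow>
        x i - (\<Sum>j<n. (int R * A i j + E i j) * x (m + j)) = int (R * M) * c i"
      by metis
    \<comment> \<open>The parent vector: the contribution of \<open>E\<close> is removed from
      \<open>x\<close> and the rest divided by \<open>R\<close>.\<close>
    define z where "z i = (if i < m then int M * c i + (\<Sum>j<n. A i j * x (m + j)) else x i)" for i
    have zV: "z \<in> intvecs (m + n)" using xV by (auto simp: z_def vecs_def)
    have gi: "int R * z i + (\<Sum>j<n. E i j * z (m + j)) = x i" if "i < m" for i
      using c[OF that] that
      by (simp add: z_def algebra_simps sum.distrib sum_distrib_left)
    have "g z = x"
    proof
      fix i show "g z i = x i" using gi by (cases "i < m") (simp_all add: g_def z_def)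
    qed
    moreover have "z \<in> form_lattice m n M A"
      using zV by (auto simp: form_lattice_def form_residue_def z_def)
    moreover have me: "meets m n R Z z E"
      unfolding meets_def using gi xb by (auto simp: z_def)
    moreover have "z \<in> int_box (m + n) (n * (R * Z) + (R * Z) + Z)"
      by (rule meets_bound[OF me assms(2,1) _ zV]) (use xb in \<open>auto simp: z_def\<close>)
    then have "z \<in> int_box (m + n) ((n + 2) * (R * Z))"
    proof (rule subsetD[OF int_box_mono, rotated])
      have "Z \<le> R * Z" using assms(1) by simp
      then show "n * (R * Z) + R * Z + Z \<le> (n + 2) * (R * Z)" by (simp add: distrib_right)
    qed
    ultimately show "x \<in> g ` S" unfolding S_def by blast
  qed
  moreover have "finite S" by (simp add: S_def)
  ultimately have "card (form_lattice m n (R * M) (child R A E) \<inter> int_box (m + n) (R * Z)) \<le> card S"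
    by (rule surj_card_le[rotated])
  then show ?thesis by (simp add: npts_def S_def)
qed

lemma card_filter_eq_sum: "finite F \<Longrightarrow> real (card {x \<in> F. P x}) = (\<Sum>x\<in>F. if P x then 1 else 0)"
  by (simp add: sum.If_cases Int_def)

text \<open>Divided by \<open>R ^ (m * n)\<close>, this bounds the probability that a random subcube
  keeps \<open>z\<close> short. If the largest entry \<open>Q\<close> of the \<open>q\<close> part
  is of order \<open>2 ^ i * Z\<close>, the probability is at most \<open>(6 / 2 ^ i) ^ m\<close>
  and \<open>z\<close> lies in the box of index \<open>i\<close>. The sum over \<open>i\<close>
  avoids naming the right index.\<close>

lemma card_meets_le:
  fixes h :: nat
  assumes "1 \<le> n" "0 < Z" "Z < M" "z \<in> form_lattice m n M A" "z \<noteq> 0"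
  defines "R \<equiv> 2 ^ h"
  shows "real (card {E \<in> intmats m n R. meets m n R Z z E})
    \<le> real R ^ (m * n) * (\<Sum>i\<le>h. (6 / 2 ^ i) ^ m * of_bool (z \<in> int_box (m + n) ((n + 2) * (2 ^ i * Z))))"
    (is "real (card ?S) \<le> _ * (\<Sum>i\<le>h. ?t i)")
proof (cases "?S = {}")
  case True
  moreover have "0 \<le> real R ^ (m * n) * (\<Sum>i\<le>h. ?t i)"
    by (intro mult_nonneg_nonneg sum_nonneg) auto
  ultimately show ?thesis by (simp only: card.empty of_nat_0)
next
  case False
  then obtain E where E: "E \<in> intmats m n R" and me: "meets m n R Z z E" by blast
  have R: "0 < R" by (simp add: R_def)
  have zV: "z \<in> intvecs (m + n)" using assms(4) by (simp add: form_lattice_def)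
  define Q where "Q = Max ((\<lambda>j. nat \<bar>z (m + j)\<bar>) ` {..<n})"
  have "Q \<in> (\<lambda>j. nat \<bar>z (m + j)\<bar>) ` {..<n}"
    unfolding Q_def using assms(1) by (intro Max_in) (auto simp: lessThan_empty_iff)
  then obtain j0 where j0: "j0 < n" "int Q = \<bar>z (m + j0)\<bar>" by auto
  have Qmax: "\<bar>z (m + j)\<bar> \<le> int Q" if "j < n" for j
  proof -
    have "nat \<bar>z (m + j)\<bar> \<le> Q" unfolding Q_def using that by (intro Max_ge) auto
    then show ?thesis by linarith
  qed
  have QRZ: "int Q \<le> int (R * Z)" using me j0 unfolding meets_def by metis
  \<comment> \<open>With \<open>q = 0\<close> the lattice condition makes the remaining entries
    multiples of \<open>M\<close>, while their size is at most \<open>Z < M\<close>; hence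
    \<open>z\<close> would vanish.\<close>
  have Q0: "Q \<noteq> 0"
  proof
    assume "Q = 0"
    then have q: "z (m + j) = 0" if "j < n" for j using Qmax[OF that] by simp
    have "z \<in> int_box (m + n) (n * 0 + 0 + Z)"
      by (rule meets_bound[OF me E R _ zV]) (use q in auto)
    then have zZ: "\<bar>z i\<bar> \<le> int Z" for i by (simp add: int_box_iff)
    have "z i = 0" for i
    proof -
      consider "i < m" | "m \<le> i" "i < m + n" | "m + n \<le> i" by linarith
      then show ?thesis
      proof cases
        case 1
        then have "int M dvd z i" using assms(4) q by (auto simp: form_lattice_def form_residue_def)
        then show ?thesis using zZ[of i] assms(3) zdvd_imp_le[of "int M" "\<bar>z i\<bar>"] by (cases "z i = 0") auto
      next
        case 2
        then show ?thesis using q[of "i - m"] by simp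
      qed (use zV in \<open>auto simp: vecs_def\<close>)
    qed
    then show False using assms(5) by (auto simp: fun_eq_iff)
  qed
  \<comment> \<open>Minimality gives \<open>2 ^ (i - 1) * Z < Q\<close> for positive
    \<open>i\<close>, whence 6 in place of 3; for \<open>i = 0\<close> the trivial bound 1 is
    enough.\<close>
  define i where "i = (LEAST i. Q \<le> 2 ^ i * Z)"
  have ex: "Q \<le> 2 ^ h * Z" using QRZ unfolding R_def by linarith
  then have i: "Q \<le> 2 ^ i * Z" "i \<le> h"
    unfolding i_def by (auto intro: LeastI Least_le)
  have "z \<in> int_box (m + n) (n * (2 ^ i * Z) + 2 ^ i * Z + Z)"
  proof (rule meets_bound[OF me E R _ zV])
    fix j assume "j < n"
    then show "\<bar>z (m + j)\<bar> \<le> int (2 ^ i * Z)" using Qmax[of j] i(1) by linarith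
  qed
  then have z_box: "z \<in> int_box (m + n) ((n + 2) * (2 ^ i * Z))"
    by (rule subsetD[OF int_box_mono, rotated]) (simp add: distrib_right)
  have "min 1 (3 * real Z / \<bar>real_of_int (z (m + j0))\<bar>) \<le> 6 / 2 ^ i"
  proof (cases i)
    case (Suc i')
    then have "\<not> Q \<le> 2 ^ i' * Z" using not_less_Least[of i' "\<lambda>i. Q \<le> 2 ^ i * Z"] by (simp add: i_def)
    then have "2 ^ i' * real Z \<le> real Q" by (metis nat_le_linear of_nat_le_iff of_nat_mult of_nat_numeral of_nat_power)
    then have "3 * real Z / real Q \<le> 6 / 2 ^ i" using Q0 by (simp add: Suc field_simps)
    moreover have "real Q = \<bar>real_of_int (z (m + j0))\<bar>" using j0(2) by (metis of_int_abs of_int_of_nat_eq)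
    ultimately show ?thesis by simp
  qed simp
  then have pw: "min 1 (3 * real Z / \<bar>real_of_int (z (m + j0))\<bar>) ^ m \<le> (6 / 2 ^ i) ^ m"
    by (intro power_mono) auto
  have "card ?S \<le> card {E \<in> intmats m n R. \<forall>i<m. \<bar>int R * z i + (\<Sum>j<n. E i j * z (m + j))\<bar> \<le> int (R * Z)}"
    by (intro card_mono) (auto simp: meets_def finite_intmats)
  then have "real (card ?S) \<le> real (card {E \<in> intmats m n R. \<forall>i<m. \<bar>int R * z i + (\<Sum>j<n. E i j * z (m + j))\<bar> \<le> int (R * Z)})"
    by simp
  also have "\<dots> \<le> real R ^ (m * n) * min 1 (3 * real Z / \<bar>real_of_int (z (m + j0))\<bar>) ^ m"
    by (rule card_intmats_le[of j0 n "\<lambda>j. z (m + j)" R Z m z]) (use j0 Q0 QRZ in auto)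
  also have "\<dots> \<le> real R ^ (m * n) * (6 / 2 ^ i) ^ m"
    using pw by (rule mult_left_mono) simp
  also have "(6 / 2 ^ i) ^ m = ?t i" using z_box by simp
  also have "?t i \<le> (\<Sum>i\<le>h. ?t i)"
    using i(2) by (intro member_le_sum) auto
  finally show ?thesis by (simp add: mult_left_mono)
qed

text \<open>Interchange the sums over subcubes and over parent vectors. The zero vector survives in
  every subcube and contributes the 1; the others are counted by dyadic size.\<close>

lemma sum_npts_child_le_shells:
  fixes h m :: nat and A :: "nat \<Rightarrow> nat \<Rightarrow> int"
  assumes "1 \<le> n" "0 < Z" "Z < M"
  defines "R \<equiv> 2 ^ h" and "L \<equiv> form_lattice m n M A"
  shows "(\<Sum>E\<in>intmats m n R. real (npts (m + n) (form_lattice m n (R * M) (child R A E)) (R * Z)))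
    \<le> real R ^ (m * n) * (1 + (\<Sum>i\<le>h. (6 / 2 ^ i) ^ m *
        real (card (L \<inter> int_box (m + n) ((n + 2) * (2 ^ i * Z)) - {0}))))"
proof -
  define F where "F = L \<inter> int_box (m + n) ((n + 2) * (R * Z))"
  define B where "B i = int_box (m + n) ((n + 2) * (2 ^ i * Z))" for i
  have R: "0 < R" by (simp add: R_def)
  have finF: "finite F" by (simp add: F_def)
  have zero: "0 \<in> F" by (auto simp: F_def L_def int_box_iff form_lattice_def form_residue_def vecs_def)
  have "(\<Sum>E\<in>intmats m n R. real (npts (m + n) (form_lattice m n (R * M) (child R A E)) (R * Z)))
      \<le> (\<Sum>E\<in>intmats m n R. real (card {z \<in> F. meets m n R Z z E}))"
    unfolding F_def L_def by (intro sum_mono of_nat_mono npts_child_le R)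
  also have "\<dots> = (\<Sum>z\<in>F. real (card {E \<in> intmats m n R. meets m n R Z z E}))"
    unfolding card_filter_eq_sum[OF finF] card_filter_eq_sum[OF finite_intmats] by (rule sum.swap)
  also have "\<dots> = real (card {E \<in> intmats m n R. meets m n R Z 0 E})
      + (\<Sum>z\<in>F - {0}. real (card {E \<in> intmats m n R. meets m n R Z z E}))"
    using finF zero by (simp add: sum.remove)
  also have "\<dots> \<le> real R ^ (m * n) + (\<Sum>z\<in>F - {0}. real R ^ (m * n) *
      (\<Sum>i\<le>h. (6 / 2 ^ i) ^ m * of_bool (z \<in> B i)))"
  proof (intro add_mono sum_mono)
    have "card {E \<in> intmats m n R. meets m n R Z 0 E} \<le> card (intmats m n R)"
      by (intro card_mono finite_intmats) auto
    then show "real (card {E \<in> intmats m n R. meets m n R Z 0 E}) \<le> real R ^ (m * n)"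
      by (simp add: card_intmats)
    fix z assume "z \<in> F - {0}"
    then show "real (card {E \<in> intmats m n R. meets m n R Z z E}) \<le> real R ^ (m * n) *
        (\<Sum>i\<le>h. (6 / 2 ^ i) ^ m * of_bool (z \<in> B i))"
      unfolding B_def R_def F_def L_def by (intro card_meets_le[where A = A and M = M] assms) auto
  qed
  also have "(\<Sum>z\<in>F - {0}. real R ^ (m * n) * (\<Sum>i\<le>h. (6 / 2 ^ i) ^ m * of_bool (z \<in> B i)))
      = real R ^ (m * n) * (\<Sum>i\<le>h. (6 / 2 ^ i) ^ m * (\<Sum>z\<in>F - {0}. of_bool (z \<in> B i)))"
    unfolding sum_distrib_left[symmetric] by (subst sum.swap) (simp add: sum_distrib_left)
  also have "\<dots> \<le> real R ^ (m * n) * (\<Sum>i\<le>h. (6 / 2 ^ i) ^ m * real (card (L \<inter> B i - {0})))"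
  proof (intro mult_left_mono sum_mono)
    fix i
    have "(\<Sum>z\<in>F - {0}. of_bool (z \<in> B i)) = real (card {z \<in> F - {0}. z \<in> B i})"
      unfolding of_bool_def by (rule card_filter_eq_sum[symmetric]) (use finF in simp)
    also have "\<dots> \<le> real (card (L \<inter> B i - {0}))"
      by (intro of_nat_mono card_mono) (auto simp: F_def B_def)
    finally show "(\<Sum>z\<in>F - {0}. of_bool (z \<in> B i)) \<le> real (card (L \<inter> B i - {0}))" .
  qed auto
  finally show ?thesis by (simp add: B_def algebra_simps)
qed

text \<open>\<open>6 ^ m\<close> comes from \<open>card_meets_le\<close>; 21 is the 7 of
  \<open>npts_mult_le\<close> times the 3 of \<open>multiple_npts_le\<close>; \<open>n + 2\<close>
  is the enlargement of the box in \<open>meets_bound\<close>; 2 merges the two summands of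
  \<open>npts_mult_le\<close>.\<close>

definition height_const :: "nat \<Rightarrow> nat \<Rightarrow> real" where
  "height_const m n = 2 * 6 ^ m * (21 * (real n + 2)) ^ (m + n)"

text \<open>The scale \<open>Y\<close> sits at the index \<open>n * l\<close>. Up to there, linear
  growth bounds the shell by a multiple of \<open>2 ^ i / 2 ^ (n * l)\<close> times the count at
  \<open>Y\<close>, and a probability of order at most \<open>1 / 2 ^ i\<close> leaves
  \<open>1 / 2 ^ (n * l)\<close>. Beyond, with \<open>t = i - n * l\<close>, the count at
  \<open>Y\<close> is multiplied by \<open>(2 ^ t) ^ (m + n - 1)\<close>, of which the probability
  leaves \<open>(2 ^ t) ^ (n - 1) / 2 ^ (n * l * m)\<close>.\<close>

lemma shell_le:
  fixes l :: nat and A :: "nat \<Rightarrow> nat \<Rightarrow> int"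
  assumes "1 \<le> m" "1 \<le> n" "0 < Z" "0 < M"
  defines "Y \<equiv> 2 ^ (n * l) * Z" and "L \<equiv> form_lattice m n M A"
  assumes "M ^ m = Y ^ (m + n)" and "i \<le> (m + n) * l"
  shows "(6 / 2 ^ i) ^ m * real (card (L \<inter> int_box (m + n) ((n + 2) * (2 ^ i * Z)) - {0}))
    \<le> height_const m n * (real (npts (m + n) L Y) / 2 ^ l + (if n * l < i then (2 ^ n) ^ (i - n * l) / 2 ^ (n * l * m) else 0))"
    (is "?lhs \<le> _ * (?N / _ + _)")
proof -
  let ?d = "m + n"
  have Y: "0 < Y" using assms by (simp add: Y_def)
  interpret finite_lattice_quotient ?d L "form_class m n M A" Y
    unfolding L_def by (rule finite_lattice_quotient_form) (use assms Y in auto)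
  define c where "c = real (card (L \<inter> int_box ?d ((n + 2) * (2 ^ i * Z)) - {0}))"
  have N: "1 \<le> ?N" using npts_pos[of Y] by linarith
  show ?thesis
  proof (cases "n * l < i")
    case False
    define s where "s = 3 * (n + 2)"
    have s1: "1 \<le> s" by (simp add: s_def)
    have pw: "(2::nat) ^ (n * l) = 2 ^ (n * l - i) * 2 ^ i"
      using False by (simp add: power_add[symmetric])
    have "2 ^ (n * l - i) * card (L \<inter> int_box ?d ((n + 2) * (2 ^ i * Z)) - {0})
        \<le> npts ?d L (3 * 2 ^ (n * l - i) * ((n + 2) * (2 ^ i * Z)))"
      by (rule multiple_npts_le)
    also have "3 * 2 ^ (n * l - i) * ((n + 2) * (2 ^ i * Z)) = s * Y"
    proof -
      have "3 * 2 ^ (n * l - i) * ((n + 2) * (2 ^ i * Z)) = 3 * (n + 2) * ((2 ^ (n * l - i) * 2 ^ i) * Z)"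
        by (simp only: ac_simps)
      then show ?thesis by (simp only: s_def Y_def pw)
    qed
    also have "npts ?d L (s * Y) \<le> 7 ^ ?d * (s ^ (?d - 1) * npts ?d L Y + s ^ ?d)"
      using s1 assms by (intro npts_mult_le) auto
    also have "\<dots> \<le> 7 ^ ?d * (s ^ ?d * npts ?d L Y + s ^ ?d * npts ?d L Y)"
      using s1 npts_pos[of Y] by (intro mult_left_mono add_mono mult_right_mono power_increasing) auto
    also have "\<dots> = 2 * (7 * s) ^ ?d * npts ?d L Y" by (simp only: power_mult_distrib mult_2 distrib_left distrib_right ac_simps)
    finally have "real (2 ^ (n * l - i) * card (L \<inter> int_box ?d ((n + 2) * (2 ^ i * Z)) - {0}))
        \<le> real (2 * (7 * s) ^ ?d * npts ?d L Y)" by (rule of_nat_mono)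
    also have "real (7 * s) = 21 * (real n + 2)" by (simp add: s_def)
    then have "real (2 * (7 * s) ^ ?d * npts ?d L Y) = 2 * (21 * (real n + 2)) ^ ?d * ?N"
      by (simp only: of_nat_mult of_nat_power of_nat_numeral)
    finally have c_le: "2 ^ (n * l - i) * c \<le> 2 * (21 * (real n + 2)) ^ ?d * ?N"
      by (simp add: c_def)
    have "?lhs * 2 ^ l \<le> (6 ^ m / 2 ^ i) * c * 2 ^ (n * l)"
    proof (intro mult_mono)
      have "(2::real) ^ i \<le> (2 ^ i) ^ m" using assms by (intro self_le_power) auto
      then show "(6 / 2 ^ i) ^ m \<le> (6::real) ^ m / 2 ^ i"
        unfolding power_divide by (intro divide_left_mono) auto
      show "(2::real) ^ l \<le> 2 ^ (n * l)" using assms by (intro power_increasing) auto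
    qed (auto simp: c_def)
    also have "\<dots> = 6 ^ m * (2 ^ (n * l - i) * c)"
    proof -
      have "(2::real) ^ (n * l) = 2 ^ (n * l - i) * 2 ^ i"
        using False by (simp add: power_add[symmetric])
      then show ?thesis by simp
    qed
    also have "\<dots> \<le> 6 ^ m * (2 * (21 * (real n + 2)) ^ ?d * ?N)"
      using c_le by (rule mult_left_mono) simp
    finally have "?lhs \<le> height_const m n * ?N / 2 ^ l"
      by (simp add: height_const_def field_simps)
    then show ?thesis using False by simp
  next
    case True
    define t where "t = i - n * l"
    have i: "i = n * l + t" and t: "t \<le> m * l"
      using True assms(8) by (auto simp: t_def algebra_simps)
    define s where "s = (n + 2) * 2 ^ t"
    have "0 < s" by (simp add: s_def)
    then have s1: "1 \<le> s" by linarith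
    have "(n + 2) * (2 ^ i * Z) = s * Y"
      by (simp only: s_def Y_def i power_add mult.assoc mult.left_commute mult.commute)
    then have "card (L \<inter> int_box ?d ((n + 2) * (2 ^ i * Z)) - {0}) \<le> npts ?d L (s * Y)"
      unfolding npts_def by (intro card_mono) auto
    also have "\<dots> \<le> 7 ^ ?d * (s ^ (?d - 1) * npts ?d L Y + s ^ ?d)"
      using s1 assms by (intro npts_mult_le) auto
    finally have "c \<le> real (7 ^ ?d * (s ^ (?d - 1) * npts ?d L Y + s ^ ?d))"
      unfolding c_def by (rule of_nat_mono)
    also have "\<dots> = 7 ^ ?d * ((real n + 2) ^ (?d - 1) * ((2 ^ t) ^ (?d - 1) * ?N) + (real n + 2) ^ ?d * (2 ^ t) ^ ?d)"
    proof -
      have "real s = (real n + 2) * 2 ^ t" by (simp add: s_def distrib_right)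
      then show ?thesis
        by (simp only: of_nat_mult of_nat_add of_nat_power of_nat_numeral power_mult_distrib mult.assoc)
    qed
    also have "\<dots> \<le> 7 ^ ?d * ((real n + 2) ^ ?d * ((2 ^ t) ^ (?d - 1) * ?N) + (real n + 2) ^ ?d * (2 ^ t) ^ ?d)"
      by (intro mult_left_mono add_mono mult_right_mono power_increasing) auto
    also have "\<dots> = (7 * (real n + 2)) ^ ?d * ((2 ^ t) ^ (?d - 1) * ?N + (2 ^ t) ^ ?d)"
    proof -
      have "7 ^ ?d * (x * (y * ?N) + x * v) = 7 ^ ?d * x * (y * ?N + v)" for x y v :: real
        by (simp add: algebra_simps)
      then show ?thesis by (simp only: power_mult_distrib)
    qed
    also have "\<dots> \<le> (21 * (real n + 2)) ^ ?d * ((2 ^ t) ^ (?d - 1) * ?N + (2 ^ t) ^ ?d)"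
      by (intro mult_right_mono power_mono) auto
    also have "(2 ^ t) ^ (?d - 1) * ?N + (2 ^ t) ^ ?d = (2 ^ t) ^ m * ((2 ^ t) ^ (n - 1) * ?N + (2 ^ t) ^ n)"
    proof -
      have "?d - 1 = m + (n - 1)" using assms by simp
      then show ?thesis by (simp add: power_add algebra_simps)
    qed
    finally have c_le: "c \<le> (21 * (real n + 2)) ^ ?d * ((2 ^ t) ^ m * ((2 ^ t) ^ (n - 1) * ?N + (2 ^ t) ^ n))" .
    have "?lhs = 6 ^ m / (2 ^ (n * l * m) * (2 ^ t) ^ m) * c"
      by (simp add: c_def i power_add power_mult_distrib power_divide power_mult)
    also have "\<dots> \<le> 6 ^ m / (2 ^ (n * l * m) * (2 ^ t) ^ m) *
        ((21 * (real n + 2)) ^ ?d * ((2 ^ t) ^ m * ((2 ^ t) ^ (n - 1) * ?N + (2 ^ t) ^ n)))"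
      using c_le by (rule mult_left_mono) simp
    also have "\<dots> = 6 ^ m * (21 * (real n + 2)) ^ ?d * (((2 ^ t) ^ (n - 1) / 2 ^ (n * l * m)) * ?N + (2 ^ t) ^ n / 2 ^ (n * l * m))"
      by (simp add: field_simps)
    also have "\<dots> \<le> 6 ^ m * (21 * (real n + 2)) ^ ?d * (1 / 2 ^ l * ?N + (2 ^ t) ^ n / 2 ^ (n * l * m))"
    proof (intro mult_left_mono add_mono mult_right_mono order_refl)
      \<comment> \<open>The worst case is the top shell \<open>t = m * l\<close>: the exponent
        \<open>n - 1\<close> leaves a gap of \<open>m * l\<close>, where the exponent
        \<open>n\<close> would leave none.\<close>
      have "t * (n - 1) \<le> m * l * (n - 1)" using t by (rule mult_right_mono) simp
      moreover have "m * l * (n - 1) + m * l = n * l * m" using assms by (cases n) (auto simp: algebra_simps)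
      moreover have "l \<le> m * l" using assms by simp
      ultimately have "t * (n - 1) + l \<le> n * l * m" by linarith
      then have "(2::real) ^ (t * (n - 1) + l) \<le> 2 ^ (n * l * m)" by (intro power_increasing) auto
      then show "(2 ^ t) ^ (n - 1) / 2 ^ (n * l * m) \<le> (1::real) / 2 ^ l"
        by (simp add: power_add power_mult field_simps)
    qed auto
    also have "\<dots> \<le> height_const m n * (1 / 2 ^ l * ?N + (2 ^ t) ^ n / 2 ^ (n * l * m))"
      unfolding height_const_def by (intro mult_right_mono) auto
    also have "(2 ^ t) ^ n = ((2::real) ^ n) ^ (i - n * l)"
      by (simp add: t_def power_mult[symmetric] mult.commute)
    finally show ?thesis using True by (simp only: if_True times_divide_eq_left mult_1_left)
  qed
qed

text \<open>In the geometric sum the largest shell dominates, so that the additive constant does not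
  depend on the scale \<open>l\<close>.\<close>

lemma sum_npts_child_le:
  fixes l :: nat and A :: "nat \<Rightarrow> nat \<Rightarrow> int"
  assumes "1 \<le> m" "1 \<le> n" "0 < Z" "Z < M"
  defines "Y \<equiv> 2 ^ (n * l) * Z" and "R \<equiv> 2 ^ ((m + n) * l)"
  assumes "M ^ m = Y ^ (m + n)"
  shows "(\<Sum>E\<in>intmats m n R. real (npts (m + n) (form_lattice m n (R * M) (child R A E)) (R * Z)))
    \<le> real R ^ (m * n) * (3 * height_const m n + height_const m n * (real ((m + n) * l + 1) / 2 ^ l)
        * real (npts (m + n) (form_lattice m n M A) Y))"
proof -
  let ?N = "real (npts (m + n) (form_lattice m n M A) Y)"
  let ?C = "height_const m n"
  \<comment> \<open>This turns the 1 of the zero vector into \<open>?C\<close>, which together with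
    \<open>2 * ?C\<close> from the geometric sum makes the additive constant
    \<open>3 * ?C\<close>.\<close>
  have C: "1 \<le> ?C"
  proof -
    have "1 * 1 \<le> (2 * 6 ^ m) * (21 * (real n + 2)) ^ (m + n)"
    proof (rule mult_mono)
      have "(1::real) \<le> 6 ^ m" by (rule one_le_power) simp
      then show "(1::real) \<le> 2 * 6 ^ m" by linarith
      show "1 \<le> (21 * (real n + 2)) ^ (m + n)" by (intro one_le_power) auto
    qed auto
    then show ?thesis by (simp add: height_const_def)
  qed
  define g where "g i = (if n * l < i then (2 ^ n) ^ (i - n * l) / 2 ^ (n * l * m) else (0::real))" for i
  have "(\<Sum>i\<le>(m + n) * l. g i) \<le> 2"
  proof -
    have "(\<Sum>i\<le>(m + n) * l. g i) = (\<Sum>i\<in>{n * l..(m + n) * l}. g i)"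
      by (rule sum.mono_neutral_right) (auto simp: g_def)
    also have "\<dots> \<le> (\<Sum>i\<in>{n * l..(m + n) * l}. (2 ^ n) ^ (i - n * l) / 2 ^ (n * l * m))"
      by (intro sum_mono) (simp add: g_def)
    also have "\<dots> = (\<Sum>t\<le>m * l. (2 ^ n) ^ t / 2 ^ (n * l * m))"
      by (rule sum.reindex_bij_witness[of _ "\<lambda>t. t + n * l" "\<lambda>i. i - n * l"]) (auto simp: algebra_simps)
    also have "\<dots> = (\<Sum>t\<le>m * l. (2 ^ n) ^ t) / 2 ^ (n * l * m)"
      by (simp add: sum_divide_distrib)
    also have "\<dots> \<le> 2"
    proof -
      have "(\<Sum>t\<le>K. x ^ t) \<le> 2 * x ^ K" if "2 \<le> x" for x :: real and K
      proof (induction K)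
        case (Suc K)
        have "2 * x ^ K \<le> x * x ^ K" using that by (intro mult_right_mono) auto
        then show ?case using Suc by simp
      qed simp
      moreover have "(2::real) ^ 1 \<le> 2 ^ n" using assms(2) by (intro power_increasing) auto
      ultimately have "(\<Sum>t\<le>m * l. (2 ^ n) ^ t) \<le> (2::real) * (2 ^ n) ^ (m * l)" by simp
      also have "((2::real) ^ n) ^ (m * l) = 2 ^ (n * l * m)"
        by (simp add: power_mult[symmetric] ac_simps)
      finally show ?thesis by (simp add: pos_divide_le_eq)
    qed
    finally show ?thesis .
  qed
  note g_sum = this
  have "(\<Sum>i\<le>(m + n) * l. (6 / 2 ^ i) ^ m *
        real (card (form_lattice m n M A \<inter> int_box (m + n) ((n + 2) * (2 ^ i * Z)) - {0})))
      \<le> (\<Sum>i\<le>(m + n) * l. ?C * (?N / 2 ^ l + g i))"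
    unfolding g_def Y_def using assms(1-4,7) unfolding Y_def by (intro sum_mono shell_le) auto
  also have "\<dots> = ?C * (real ((m + n) * l + 1) * (?N / 2 ^ l) + (\<Sum>i\<le>(m + n) * l. g i))"
    by (simp add: sum_distrib_left[symmetric] sum.distrib)
  also have "\<dots> \<le> ?C * (real ((m + n) * l + 1) * (?N / 2 ^ l) + 2)"
    using g_sum C by (intro mult_left_mono add_left_mono) auto
  finally have "1 + (\<Sum>i\<le>(m + n) * l. (6 / 2 ^ i) ^ m *
        real (card (form_lattice m n M A \<inter> int_box (m + n) ((n + 2) * (2 ^ i * Z)) - {0})))
      \<le> 3 * ?C + ?C * (real ((m + n) * l + 1) / 2 ^ l) * ?N"
    using C by (simp add: algebra_simps)
  then have "real R ^ (m * n) * (1 + (\<Sum>i\<le>(m + n) * l. (6 / 2 ^ i) ^ m *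
        real (card (form_lattice m n M A \<inter> int_box (m + n) ((n + 2) * (2 ^ i * Z)) - {0}))))
      \<le> real R ^ (m * n) * (3 * ?C + ?C * (real ((m + n) * l + 1) / 2 ^ l) * ?N)"
    by (rule mult_left_mono) simp
  then show ?thesis
    unfolding R_def by (rule order_trans[OF sum_npts_child_le_shells[OF assms(2-4)]])
qed

section \<open>Dead subcubes and the potential\<close>

text \<open>The lower limit with an explicit threshold \<open>K\<close>, and with witnesses
  \<open>p\<close>, \<open>Q\<close> and \<open>e\<close> for the integer vector, the norm of
  \<open>q\<close> and the error, so that infima and maxima disappear. For
  \<open>\<eta> < \<epsilon>\<close>, countably many \<open>K\<close> cover the bad set of
  \<open>\<epsilon>\<close>.\<close>

definition uniformly_bad :: "nat \<Rightarrow> nat \<Rightarrow> (nat \<Rightarrow> real) \<Rightarrow> real \<Rightarrow> nat \<Rightarrow> (nat \<Rightarrow> nat \<Rightarrow> real) set" where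
  "uniformly_bad m n b \<eta> K = {a. \<forall>(q :: nat \<Rightarrow> int) (p :: nat \<Rightarrow> int) Q e.
     K \<le> Q \<and> 0 \<le> e \<and> (\<forall>j<n. \<bar>q j\<bar> \<le> int Q) \<and> (\<exists>j<n. \<bar>q j\<bar> = int Q) \<and>
     (\<forall>i<m. \<bar>(\<Sum>j<n. a i j * real_of_int (q j)) - b i - real_of_int (p i)\<bar> \<le> e) \<longrightarrow>
     \<eta> \<le> real Q ^ n * e ^ m}"

lemma uniformly_badD:
  assumes "a \<in> uniformly_bad m n b \<eta> K" "K \<le> Q" "0 \<le> e" "\<And>j. j < n \<Longrightarrow> \<bar>q j\<bar> \<le> int Q"
    and "\<exists>j<n. \<bar>q j\<bar> = int Q"
    and "\<And>i. i < m \<Longrightarrow> \<bar>(\<Sum>j<n. a i j * real_of_int (q j)) - b i - real_of_int (p i)\<bar> \<le> e"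
  shows "\<eta> \<le> real Q ^ n * e ^ m"
  using assms unfolding uniformly_bad_def by blast

text \<open>When the covering radius is bounded, some point of the affine lattice has its first \<open>q\<close>
  coordinate dominant and of the right sign; changing only the first column of the matrix then
  moves that point onto the subspace where the form vanishes.\<close>

lemma exists_dead_child:
  fixes A :: "nat \<Rightarrow> nat \<Rightarrow> int" and b :: "nat \<Rightarrow> real"
  assumes mn: "1 \<le> m" "1 \<le> n" and pos: "0 < M" "0 < Y" "0 < R" "0 < H" and MY: "M ^ m = Y ^ (m + n)"
    and npts: "npts (m + n) (form_lattice m n M A) Y \<le> H" and K: "K \<le> H * Y"
    and small: "(9 * real H) ^ n * (9 * (real n + 1) * real H / real R + 1 / real Y) ^ m < \<eta>"
  obtains E where "E \<in> intmats m n R"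
    and "\<And>a. a \<in> uniformly_bad m n b \<eta> K \<Longrightarrow>
      \<not> (\<forall>i<m. \<forall>j<n. \<lfloor>real (R * M) * a i j\<rfloor> = child R A E i j)"
proof -
  interpret finite_lattice_quotient "m + n" "form_lattice m n M A" "form_class m n M A" Y
    by (rule finite_lattice_quotient_form) (use pos MY in auto)
  define T where "T = int (H * Y)"
  have T: "0 < T" using pos by (simp add: T_def)
  define \<beta> where "\<beta> i = \<lfloor>real M * b i\<rfloor>" for i
  \<comment> \<open>As \<open>z\<close> lies in the box of radius \<open>2 * T\<close>, these shifts
    put \<open>u\<close> between \<open>- 4 * T\<close> and 0 and \<open>q 0\<close> between
    \<open>5 * T\<close> and \<open>9 * T\<close>, while the other \<open>q j\<close> stay within
    \<open>2 * T\<close>. So \<open>- u i / q 0\<close> lies in [0, 1), and its multiple by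
    \<open>R\<close>, rounded down, is an admissible entry of \<open>E\<close>.\<close>
  define w where "w i = (if i < m then 2 * T - \<beta> i else if i = m then - 7 * T else 0)" for i
  have w: "w \<in> intvecs (m + n)" using mn by (auto simp: w_def vecs_def)
  then obtain z where z: "z \<in> int_box (m + n) (2 * H * Y)" "form_class m n M A w = form_class m n M A z"
    using image_box_eq[OF npts] by blast
  have z_le: "\<bar>z i\<bar> \<le> 2 * T" for i using z(1) by (simp add: int_box_iff T_def mult.assoc)
  have "z - w \<in> form_lattice m n M A"
    using form_class_eq_iff[of z m n w M A] z w int_box_subset_intvecs by (metis subsetD)
  then have "\<exists>c. i < m \<longrightarrow> form_residue m n A (z - w) i = int M * c" for i
    by (auto simp: form_lattice_def dvd_def)
  then obtain c where c: "\<And>i. i < m \<Longrightarrow> form_residue m n A (z - w) i = int M * c i" by metis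
  define q where "q j = z (m + j) - w (m + j)" for j
  define u where "u i = z i - 2 * T" for i
  have Aq: "(\<Sum>j<n. A i j * q j) = u i + \<beta> i - int M * c i" if "i < m" for i
    using c[OF that] that by (simp add: form_residue_def q_def u_def w_def)
  have q0: "5 * T \<le> q 0" "q 0 \<le> 9 * T" using z_le[of m] by (auto simp: q_def w_def)
  have q_le: "\<bar>q j\<bar> \<le> q 0" if "j < n" for j
    using z_le[of "m + j"] q0 T by (cases "j = 0") (auto simp: q_def w_def)
  have u: "- 4 * T \<le> u i" "u i \<le> 0" for i using z_le[of i] by (auto simp: u_def)
  define e where "e i = \<lfloor>- (real R * real_of_int (u i)) / real_of_int (q 0)\<rfloor>" for i
  have q0_pos: "0 < real_of_int (q 0)" using q0 T by linarith
  have e_nonneg: "0 \<le> e i" for i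
  proof -
    have "real R * real_of_int (u i) \<le> 0" using u(2)[of i] by (intro mult_nonneg_nonpos) auto
    then have "0 \<le> - (real R * real_of_int (u i)) / real_of_int (q 0)"
      using q0_pos by (intro divide_nonneg_pos) auto
    then show ?thesis by (simp add: e_def)
  qed
  have e_less: "e i < int R" for i
  proof -
    have "- u i < q 0" using u(1)[of i] q0 T by linarith
    then have "- real_of_int (u i) < real_of_int (q 0)" by linarith
    then have "real R * - real_of_int (u i) < real R * real_of_int (q 0)"
      using pos by (intro mult_strict_left_mono) auto
    then have "- (real R * real_of_int (u i)) / real_of_int (q 0) < real R"
      by (simp only: pos_divide_less_eq[OF q0_pos] mult_minus_right)
    then show ?thesis unfolding e_def by linarith
  qed
  have e_close: "\<bar>real R * real_of_int (u i) + real_of_int (e i) * real_of_int (q 0)\<bar> \<le> real_of_int (q 0)" for i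
  proof -
    define x where "x = - (real R * real_of_int (u i)) / real_of_int (q 0)"
    have "real R * real_of_int (u i) = - x * real_of_int (q 0)" using q0_pos by (simp add: x_def)
    then have "real R * real_of_int (u i) + real_of_int (e i) * real_of_int (q 0)
        = (real_of_int \<lfloor>x\<rfloor> - x) * real_of_int (q 0)" by (simp add: e_def x_def algebra_simps)
    moreover have "\<bar>real_of_int \<lfloor>x\<rfloor> - x\<bar> \<le> 1" by linarith
    ultimately show ?thesis using q0_pos by (simp add: abs_mult mult_left_le_one_le)
  qed
  define E where "E = (\<lambda>i (j :: nat). if i < m \<and> j = 0 then e i else (0 :: int))"
  have E: "E \<in> intmats m n R"
    using mn e_nonneg e_less pos by (auto simp: E_def vecs_def fun_eq_iff)
  have Eq: "(\<Sum>j<n. real_of_int (E i j) * real_of_int (q j)) = real_of_int (e i) * real_of_int (q 0)"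
    if "i < m" for i
  proof -
    have "(\<Sum>j<n. real_of_int (E i j) * real_of_int (q j)) = (\<Sum>j\<in>{0}. real_of_int (E i j) * real_of_int (q j))"
      using mn by (intro sum.mono_neutral_right) (auto simp: E_def)
    then show ?thesis using that by (simp add: E_def)
  qed
  have "\<not> (\<forall>i<m. \<forall>j<n. \<lfloor>real (R * M) * a i j\<rfloor> = child R A E i j)"
    if bad: "a \<in> uniformly_bad m n b \<eta> K" for a
  proof
    assume fl: "\<forall>i<m. \<forall>j<n. \<lfloor>real (R * M) * a i j\<rfloor> = child R A E i j"
    define \<theta> where "\<theta> i j = real (R * M) * a i j - real_of_int (child R A E i j)" for i j
    have \<theta>: "\<bar>\<theta> i j\<bar> \<le> 1" if "i < m" "j < n" for i j
      using fl that floor_correct[of "real (R * M) * a i j"] unfolding \<theta>_def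
      by (smt (verit) of_int_1 of_int_add)
    define Q where "Q = nat (q 0)"
    have Q: "int Q = q 0" using q0 T by (simp add: Q_def)
    have RM: "0 < real R * real M" using pos by simp
    \<comment> \<open>In units of \<open>1 / (R * M)\<close>, rounding \<open>e\<close> costs
      \<open>Q\<close>, the position inside the subcube \<open>n * Q\<close>, and rounding
      \<open>M * b i\<close> costs \<open>R\<close>.\<close>
    define \<epsilon> where "\<epsilon> = ((real n + 1) * real Q + real R) / (real R * real M)"
    have \<epsilon>: "0 \<le> \<epsilon>" by (simp add: \<epsilon>_def)
    have "\<bar>(\<Sum>j<n. a i j * real_of_int (q j)) - b i - real_of_int (- c i)\<bar> \<le> \<epsilon>" if i: "i < m" for i
    proof -
      have "real R * real M * (\<Sum>j<n. a i j * real_of_int (q j))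
          = (\<Sum>j<n. (real R * real_of_int (A i j) + real_of_int (E i j) + \<theta> i j) * real_of_int (q j))"
        unfolding sum_distrib_left by (intro sum.cong) (auto simp: \<theta>_def child_def algebra_simps)
      also have "\<dots> = real R * real_of_int (\<Sum>j<n. A i j * q j) + (\<Sum>j<n. real_of_int (E i j) * real_of_int (q j))
          + (\<Sum>j<n. \<theta> i j * real_of_int (q j))"
        by (simp add: distrib_right sum.distrib sum_distrib_left mult.assoc)
      also have "\<dots> = real R * (real_of_int (u i) + real_of_int (\<beta> i) - real M * real_of_int (c i))
          + real_of_int (e i) * real_of_int (q 0) + (\<Sum>j<n. \<theta> i j * real_of_int (q j))"
        by (simp only: Aq[OF i] Eq[OF i] of_int_add of_int_diff of_int_mult of_int_of_nat_eq)
      finally have "real R * real M * ((\<Sum>j<n. a i j * real_of_int (q j)) - b i - real_of_int (- c i))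
          = (real R * real_of_int (u i) + real_of_int (e i) * real_of_int (q 0))
          + real R * (real_of_int (\<beta> i) - real M * b i) + (\<Sum>j<n. \<theta> i j * real_of_int (q j))"
        by (simp add: algebra_simps)
      also have "\<bar>\<dots>\<bar> \<le> real Q + real R + real n * real Q"
      proof -
        have 1: "\<bar>real R * real_of_int (u i) + real_of_int (e i) * real_of_int (q 0)\<bar> \<le> real Q"
          using e_close[of i] Q by (metis of_int_of_nat_eq)
        have "\<bar>real_of_int (\<beta> i) - real M * b i\<bar> \<le> 1" unfolding \<beta>_def by linarith
        then have 2: "\<bar>real R * (real_of_int (\<beta> i) - real M * b i)\<bar> \<le> real R"
          by (simp add: abs_mult mult_left_le)
        have "\<bar>\<Sum>j<n. \<theta> i j * real_of_int (q j)\<bar> \<le> (\<Sum>j<n. 1 * real Q)"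
        proof (rule order_trans[OF sum_abs sum_mono])
          fix j assume j: "j \<in> {..<n}"
          then have "\<bar>real_of_int (q j)\<bar> \<le> real Q" using q_le[of j] Q
            by (metis lessThan_iff of_int_abs of_int_le_iff of_int_of_nat_eq)
          then show "\<bar>\<theta> i j * real_of_int (q j)\<bar> \<le> 1 * real Q"
            unfolding abs_mult using \<theta>[of i j] i j by (intro mult_mono) auto
        qed
        then show ?thesis using 1 2 by simp
      qed
      also have "\<dots> = (real n + 1) * real Q + real R" by (simp add: algebra_simps)
      finally have "real R * real M * \<bar>(\<Sum>j<n. a i j * real_of_int (q j)) - b i - real_of_int (- c i)\<bar>
          \<le> (real n + 1) * real Q + real R"
        by (simp only: abs_mult abs_of_nat)
      then show ?thesis unfolding \<epsilon>_def using RM by (simp add: pos_le_divide_eq mult.commute)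
    qed
    note approx = this
    have "K \<le> Q" using K Q q0 T unfolding T_def by linarith
    moreover have "\<bar>q j\<bar> \<le> int Q" if "j < n" for j using q_le[OF that] Q by simp
    moreover have "\<exists>j<n. \<bar>q j\<bar> = int Q" using mn Q q0 T by (intro exI[of _ 0]) auto
    ultimately have "\<eta> \<le> real Q ^ n * \<epsilon> ^ m"
      using uniformly_badD[OF bad _ \<epsilon> _ _ approx] by blast
    \<comment> \<open>With \<open>Q\<close> at most \<open>9 * H * Y\<close>, the scale cancels
      through \<open>Y ^ (m + n) = M ^ m\<close>, and only the quantity of \<open>small\<close> is
      left.\<close>
    also have "\<dots> \<le> (9 * real H * real Y) ^ n *
        ((9 * (real n + 1) * real H / real R + 1 / real Y) * (real Y / real M)) ^ m"
    proof (intro mult_mono power_mono)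
      have "int Q \<le> int (9 * (H * Y))" using Q q0 by (simp add: T_def)
      then show Q9: "real Q \<le> 9 * real H * real Y"
        by (metis mult.assoc of_nat_le_iff of_nat_mult of_nat_numeral)
      have "\<epsilon> \<le> ((real n + 1) * (9 * real H * real Y) + real R) / (real R * real M)"
        unfolding \<epsilon>_def using Q9 by (intro divide_right_mono add_mono mult_left_mono) auto
      also have "\<dots> = (9 * (real n + 1) * real H / real R + 1 / real Y) * (real Y / real M)"
        using pos by (simp add: field_simps)
      finally show "\<epsilon> \<le> (9 * (real n + 1) * real H / real R + 1 / real Y) * (real Y / real M)" .
    qed (use \<epsilon> in auto)
    also have "\<dots> = (9 * real H) ^ n * (9 * (real n + 1) * real H / real R + 1 / real Y) ^ m
        * (real Y ^ (m + n) / real M ^ m)"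
    proof -
      have "(h * y) ^ n * (x * (y / v)) ^ m = h ^ n * x ^ m * (y ^ (m + n) / v ^ m)" for h x y v :: real
        by (simp add: power_mult_distrib power_divide power_add)
      then show ?thesis .
    qed
    also have "real Y ^ (m + n) / real M ^ m = 1"
    proof -
      have "real (M ^ m) = real (Y ^ (m + n))" by (simp only: MY)
      then have "real M ^ m = real Y ^ (m + n)" by (simp only: of_nat_power)
      then show ?thesis using pos by simp
    qed
    finally show False using small by simp
  qed
  then show ?thesis using that E by blast
qed

section \<open>The potential and the number of surviving cubes\<close>

text \<open>\<open>\<kappa>\<close> is chosen so that the additive constants of all subcubes
  together cost \<open>P * \<kappa> * C = 1 / 2\<close>. A low cube loses one subcube and pays this
  half, a net gain of one half. A high cube may lose none, but \<open>4 * C \<le> H\<close> gives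
  \<open>P * \<kappa> * N t \<ge> 2\<close>, and the contraction by \<open>lam \<le> 1 / 4\<close>
  frees enough of this to pay.\<close>

lemma potential_step:
  fixes N :: "'a \<Rightarrow> real" and N' :: "'b \<Rightarrow> real" and ch :: "'a \<Rightarrow> 'e \<Rightarrow> 'b"
  assumes fin: "finite T" "finite F" and P: "P = real (card F)" "2 \<le> P" and C: "0 < C"
    and lam: "lam \<le> 1 / 4" and H: "4 * C \<le> H"
    and sub: "\<And>t'. t' \<in> T' \<Longrightarrow> \<exists>t\<in>T. \<exists>E\<in>F. t' = ch t E"
    and dead: "\<And>t. t \<in> T \<Longrightarrow> N t \<le> H \<Longrightarrow> \<exists>E\<in>F. ch t E \<notin> T'"
    and N: "\<And>t. 0 \<le> N t" "\<And>t'. 0 \<le> N' t'"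
    and avg: "\<And>t. t \<in> T \<Longrightarrow> (\<Sum>E\<in>F. N' (ch t E)) \<le> P * (C + lam * N t)"
  defines "\<kappa> \<equiv> 1 / (2 * C * P)"
  shows "(\<Sum>t\<in>T'. 1 + \<kappa> * N' t) \<le> (P - 1 / 2) * (\<Sum>t\<in>T. 1 + \<kappa> * N t)"
proof -
  have \<kappa>: "0 < \<kappa>" using C P by (simp add: \<kappa>_def)
  have \<kappa>C: "P * (\<kappa> * C) = 1 / 2" using C P(2) by (simp add: \<kappa>_def)
  define S where "S = (SIGMA t:T. {E \<in> F. ch t E \<in> T'})"
  have finS: "finite S" using fin by (auto simp: S_def)
  have "T' \<subseteq> (\<lambda>(t, E). ch t E) ` S"
    using sub by (fastforce simp: S_def)
  then have "(\<Sum>t\<in>T'. 1 + \<kappa> * N' t) \<le> (\<Sum>t\<in>(\<lambda>(t, E). ch t E) ` S. 1 + \<kappa> * N' t)"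
    using finS \<kappa> N by (intro sum_mono2) auto
  also have "\<dots> \<le> (\<Sum>(t, E)\<in>S. 1 + \<kappa> * N' (ch t E))"
    using sum_image_le[OF finS, of "\<lambda>t'. 1 + \<kappa> * N' t'" "\<lambda>(t, E). ch t E"] \<kappa> N
    by (simp add: case_prod_unfold)
  also have "\<dots> = (\<Sum>t\<in>T. \<Sum>E\<in>{E \<in> F. ch t E \<in> T'}. 1 + \<kappa> * N' (ch t E))"
    unfolding S_def using fin by (subst sum.Sigma) auto
  also have "\<dots> \<le> (\<Sum>t\<in>T. (P - 1 / 2) * (1 + \<kappa> * N t))"
  proof (rule sum_mono)
    fix t assume t: "t \<in> T"
    let ?F = "{E \<in> F. ch t E \<in> T'}"
    have finF: "finite ?F" using fin by simp
    have "(\<Sum>E\<in>?F. 1 + \<kappa> * N' (ch t E)) = real (card ?F) + \<kappa> * (\<Sum>E\<in>?F. N' (ch t E))"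
      by (simp add: sum.distrib sum_distrib_left)
    also have "\<dots> \<le> real (card ?F) + \<kappa> * (P * (C + lam * N t))"
    proof -
      have "(\<Sum>E\<in>?F. N' (ch t E)) \<le> (\<Sum>E\<in>F. N' (ch t E))"
        using fin N by (intro sum_mono2) auto
      then show ?thesis using avg[OF t] \<kappa> by (intro add_left_mono mult_left_mono) auto
    qed
    also have "\<dots> = real (card ?F) + 1 / 2 + lam * (P * (\<kappa> * N t))"
      using \<kappa>C by (simp add: algebra_simps)
    also have "\<dots> \<le> real (card ?F) + 1 / 2 + 1 / 4 * (P * (\<kappa> * N t))"
      using lam \<kappa> N(1)[of t] P(2) by (intro add_left_mono mult_right_mono) auto
    also have "\<dots> \<le> (P - 1 / 2) * (1 + \<kappa> * N t)"
    proof (cases "N t \<le> H")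
      case True
      then obtain E where "E \<in> F" "ch t E \<notin> T'" using dead t by blast
      then have "card ?F \<le> card (F - {E})" using fin by (intro card_mono) auto
      then have "card ?F \<le> card F - 1" using \<open>E \<in> F\<close> by simp
      moreover have "1 \<le> card F" using \<open>E \<in> F\<close> fin by (metis One_nat_def Suc_leI card_gt_0_iff empty_iff)
      ultimately have "real (card ?F) \<le> P - 1" using P by linarith
      moreover have "1 / 4 * (P * (\<kappa> * N t)) \<le> (P - 1 / 2) * (\<kappa> * N t)"
        using mult_right_mono[of "1 / 4 * P" "P - 1 / 2" "\<kappa> * N t"] P(2) \<kappa> N(1)[of t] by simp
      ultimately show ?thesis by (simp add: algebra_simps)
    next
      case False
      have "card ?F \<le> card F" using fin by (intro card_mono) auto
      then have "real (card ?F) \<le> P" using P by simp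
      moreover have "1 \<le> P * (\<kappa> * N t) / 2"
      proof -
        have "P * (\<kappa> * (4 * C)) \<le> P * (\<kappa> * N t)"
          using False H \<kappa> P(2) by (intro mult_left_mono) auto
        moreover have "P * (\<kappa> * (4 * C)) = 2" using \<kappa>C by (simp add: algebra_simps)
        ultimately show ?thesis by simp
      qed
      moreover have "3 / 4 * P * (\<kappa> * N t) \<le> (P - 1 / 2) * (\<kappa> * N t)"
        using mult_right_mono[of "3 / 4 * P" "P - 1 / 2" "\<kappa> * N t"] P(2) \<kappa> N(1)[of t] by simp
      ultimately show ?thesis by (simp add: algebra_simps)
    qed
    finally show "(\<Sum>E\<in>?F. 1 + \<kappa> * N' (ch t E)) \<le> (P - 1 / 2) * (1 + \<kappa> * N t)" .
  qed
  finally show ?thesis by (simp add: sum_distrib_left)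
qed

definition cell :: "nat \<Rightarrow> nat \<Rightarrow> nat \<Rightarrow> (nat \<Rightarrow> nat \<Rightarrow> real) \<Rightarrow> nat \<Rightarrow> nat \<Rightarrow> int" where
  "cell m n M a = (\<lambda>i j. if i < m \<and> j < n then \<lfloor>real M * a i j\<rfloor> else 0)"

lemma cell_child:
  assumes "0 < R"
  obtains E where "E \<in> intmats m n R" "cell m n (R * M) a = child R (cell m n M a) E"
proof
  define E where "E = (\<lambda>i j. if i < m \<and> j < n then \<lfloor>real (R * M) * a i j\<rfloor> - int R * \<lfloor>real M * a i j\<rfloor> else 0)"
  have "0 \<le> E i j \<and> E i j < int R" if "i < m" "j < n" for i j
  proof -
    define x where "x = real M * a i j"
    have "real R * real_of_int \<lfloor>x\<rfloor> \<le> real R * x" by (intro mult_left_mono) auto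
    moreover have "real R * x < real R * (real_of_int \<lfloor>x\<rfloor> + 1)"
      using assms by (intro mult_strict_left_mono) auto
    ultimately have "int R * \<lfloor>x\<rfloor> \<le> \<lfloor>real R * x\<rfloor>" "\<lfloor>real R * x\<rfloor> < int R * (\<lfloor>x\<rfloor> + 1)"
      by (simp_all add: le_floor_iff floor_less_iff)
    then show ?thesis using that by (simp add: E_def x_def algebra_simps)
  qed
  then show "E \<in> intmats m n R" by (auto simp: vecs_def E_def fun_eq_iff)
  show "cell m n (R * M) a = child R (cell m n M a) E"
    by (auto simp: cell_def child_def E_def fun_eq_iff)
qed

text \<open>\<open>H\<close> is \<open>4 * C\<close> rounded up for the additive constant
  \<open>C = 3 * height_const m n\<close>, hence independent of \<open>l\<close>. Starting at
  \<open>k0 \<ge> m + n\<close> makes \<open>Y\<close> at least \<open>R\<close>, so that rounding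
  \<open>b\<close> costs no more than \<open>1 / R\<close>, and makes \<open>Y / 2 ^ (n * l)\<close>
  an integer; \<open>k0 \<ge> K\<close> puts the vectors \<open>q\<close> of
  \<open>exists_dead_child\<close> beyond the threshold.\<close>

lemma card_cells_le:
  fixes b :: "nat \<Rightarrow> real" and K k0 l :: nat
  assumes mn: "1 \<le> m" "1 \<le> n" and l: "1 \<le> l"
    and lam: "height_const m n * (real ((m + n) * l + 1) / 2 ^ l) \<le> 1 / 4"
  defines "H \<equiv> nat \<lceil>12 * height_const m n\<rceil>"
  assumes small: "(9 * real H) ^ n * ((9 * (real n + 1) * real H + 1) / 2 ^ ((m + n) * l)) ^ m < \<eta>"
    and k0: "m + n \<le> k0" "K \<le> k0"
    and X: "X \<subseteq> uniformly_bad m n b \<eta> K" "finite (cell m n (2 ^ ((m + n) * l * k0)) ` X)"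
  obtains W where "0 \<le> W"
    and "\<And>t. finite (cell m n (2 ^ ((m + n) * l * (k0 + t))) ` X)"
    and "\<And>t. real (card (cell m n (2 ^ ((m + n) * l * (k0 + t))) ` X)) \<le> W * (2 ^ ((m + n) * l * (m * n)) - 1 / 2) ^ t"
proof -
  let ?d = "m + n"
  define R :: nat where "R = 2 ^ (?d * l)"
  define P where "P = real (card (intmats m n R))"
  define C where "C = 3 * height_const m n"
  define lm where "lm = height_const m n * (real (?d * l + 1) / 2 ^ l)"
  define M :: "nat \<Rightarrow> nat" where "M t = 2 ^ (?d * l * (k0 + t))" for t
  define Y :: "nat \<Rightarrow> nat" where "Y t = 2 ^ (m * l * (k0 + t))" for t
  define T where "T t = cell m n (M t) ` X" for t
  define N where "N t A = real (npts ?d (form_lattice m n (M t) A) (Y t))" for t A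
  define \<kappa> where "\<kappa> = 1 / (2 * C * P)"
  define w where "w t = (\<Sum>A\<in>T t. 1 + \<kappa> * N t A)" for t
  have hc: "0 < height_const m n" by (simp add: height_const_def)
  then have C: "0 < C" by (simp add: C_def)
  have H: "0 < H" "4 * C \<le> real H"
    using hc by (simp_all add: H_def C_def)
  have R: "0 < R" by (simp add: R_def)
  have Peq: "P = 2 ^ (?d * l * (m * n))"
    unfolding P_def card_intmats by (simp add: R_def power_mult)
  have P: "2 \<le> P"
  proof -
    have "(2::real) ^ 1 \<le> 2 ^ (?d * l * (m * n))"
      using mn l by (intro power_increasing) (auto simp: Suc_le_eq)
    then show ?thesis by (simp add: Peq)
  qed
  have M_Suc: "M (Suc t) = R * M t" for t by (simp add: M_def R_def power_add[symmetric] algebra_simps)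
  have finT: "finite (T t)" for t
  proof (induction t)
    case 0
    then show ?case using X(2) by (simp add: T_def M_def)
  next
    case (Suc t)
    have "T (Suc t) \<subseteq> (\<lambda>(A, E). child R A E) ` (T t \<times> intmats m n R)"
    proof
      fix A assume "A \<in> T (Suc t)"
      then obtain a where a: "a \<in> X" "A = cell m n (R * M t) a" unfolding T_def M_Suc by blast
      obtain E where "E \<in> intmats m n R" "A = child R (cell m n (M t) a) E"
        using cell_child[OF R, of m n "M t" a] a(2) by metis
      moreover have "cell m n (M t) a \<in> T t" using a(1) by (simp add: T_def)
      ultimately show "A \<in> (\<lambda>(A, E). child R A E) ` (T t \<times> intmats m n R)"
        by (intro image_eqI[of _ _ "(cell m n (M t) a, E)"]) simp_all
    qed
    then show ?case using Suc finite_intmats finite_subset by blast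
  qed
  have step: "w (Suc t) \<le> (P - 1 / 2) * w t" for t
    unfolding w_def \<kappa>_def
  proof (rule potential_step[where ch = "child R" and F = "intmats m n R" and lam = lm and H = "real H"])
    show "finite (T t)" by (rule finT)
    show "finite (intmats m n R)" by (rule finite_intmats)
    show "lm \<le> 1 / 4" using lam by (simp add: lm_def)
    show "\<exists>A\<in>T t. \<exists>E\<in>intmats m n R. A' = child R A E" if A': "A' \<in> T (Suc t)" for A'
    proof -
      obtain a where "a \<in> X" "A' = cell m n (R * M t) a" using A' unfolding T_def M_Suc by blast
      moreover obtain E where "E \<in> intmats m n R" "cell m n (R * M t) a = child R (cell m n (M t) a) E"
        using cell_child[OF R] by metis
      ultimately show ?thesis unfolding T_def by blast
    qed
    have index: "M t ^ m = Y t ^ ?d"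
      by (simp add: M_def Y_def power_mult[symmetric] ac_simps)
    have pos: "0 < M t" "0 < Y t" by (simp_all add: M_def Y_def)
    have m_le: "k0 + t \<le> m * (k0 + t)" using mn by simp
    show "\<exists>E\<in>intmats m n R. child R A E \<notin> T (Suc t)" if "N t A \<le> real H" for A
    proof -
      have np: "npts ?d (form_lattice m n (M t) A) (Y t) \<le> H" using that by (simp add: N_def)
      have KY: "K \<le> H * Y t"
      proof -
        have "k0 + t \<le> m * l * (k0 + t)" using mn l by simp
        also have "\<dots> < Y t" unfolding Y_def by (rule less_exp)
        also have "\<dots> \<le> H * Y t" using H by simp
        finally show ?thesis using k0 by linarith
      qed
      have "?d * l \<le> m * l * (k0 + t)"
      proof -
        have "?d * l \<le> (k0 + t) * l" using k0 by (intro mult_right_mono) auto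
        also have "\<dots> \<le> m * (k0 + t) * l" using m_le by (rule mult_right_mono) simp
        finally show ?thesis by (simp only: ac_simps)
      qed
      then have "R \<le> Y t" unfolding R_def Y_def by (intro power_increasing) auto
      then have "1 / real (Y t) \<le> 1 / real R" using R by (intro divide_left_mono) auto
      then have "9 * (real n + 1) * real H / real R + 1 / real (Y t)
          \<le> (9 * (real n + 1) * real H + 1) / real R" by (simp add: add_divide_distrib)
      then have "(9 * real H) ^ n * (9 * (real n + 1) * real H / real R + 1 / real (Y t)) ^ m
          \<le> (9 * real H) ^ n * ((9 * (real n + 1) * real H + 1) / real R) ^ m"
        by (intro mult_left_mono power_mono) auto
      also have "\<dots> < \<eta>" using small by (simp add: R_def)
      finally obtain E where E: "E \<in> intmats m n R"
        and dead: "\<And>a. a \<in> uniformly_bad m n b \<eta> K \<Longrightarrow>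
          \<not> (\<forall>i<m. \<forall>j<n. \<lfloor>real (R * M t) * a i j\<rfloor> = child R A E i j)"
        using exists_dead_child[OF mn pos R H(1) index np KY] by blast
      have "child R A E \<notin> T (Suc t)"
      proof
        assume "child R A E \<in> T (Suc t)"
        then obtain a where a: "a \<in> X" "child R A E = cell m n (R * M t) a" unfolding T_def M_Suc by blast
        then have "\<forall>i<m. \<forall>j<n. \<lfloor>real (R * M t) * a i j\<rfloor> = child R A E i j" by (simp add: cell_def)
        then show False using dead a X(1) by blast
      qed
      then show ?thesis using E by blast
    qed
    show "(\<Sum>E\<in>intmats m n R. N (Suc t) (child R A E)) \<le> P * (C + lm * N t A)" for A
    proof -
      \<comment> \<open>\<open>Z\<close> lies below \<open>Y t\<close> by the factor
        \<open>2 ^ (n * l)\<close>, so that \<open>R * Z\<close> is the scale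
        \<open>Y (Suc t)\<close> of the next generation.\<close>
      define Z :: nat where "Z = 2 ^ (m * l * (k0 + t) - n * l)"
      have le: "n * l \<le> m * l * (k0 + t)"
      proof -
        have "n * l \<le> (k0 + t) * l" using k0 by (intro mult_right_mono) auto
        also have "\<dots> \<le> m * (k0 + t) * l" using m_le by (rule mult_right_mono) simp
        finally show ?thesis by (simp only: ac_simps)
      qed
      have YZ: "Y t = 2 ^ (n * l) * Z"
        using le by (simp add: Y_def Z_def power_add[symmetric])
      have RZ: "R * Z = Y (Suc t)"
      proof -
        have "?d * l + (m * l * (k0 + t) - n * l) = m * l * (k0 + Suc t)"
          using le by (simp add: algebra_simps)
        then show ?thesis by (simp add: R_def Z_def Y_def power_add[symmetric])
      qed
      have ZM: "Z < M t"
        unfolding Z_def M_def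
      proof (rule power_strict_increasing)
        have "0 < n * l * (k0 + t)" using mn l k0 by simp
        moreover have "?d * l * (k0 + t) = m * l * (k0 + t) + n * l * (k0 + t)" by (simp add: algebra_simps)
        ultimately show "m * l * (k0 + t) - n * l < ?d * l * (k0 + t)" by linarith
      qed simp
      have "(\<Sum>E\<in>intmats m n R. real (npts ?d (form_lattice m n (R * M t) (child R A E)) (R * Z)))
          \<le> real R ^ (m * n) * (3 * height_const m n + height_const m n * (real (?d * l + 1) / 2 ^ l)
            * real (npts ?d (form_lattice m n (M t) A) (2 ^ (n * l) * Z)))"
        unfolding R_def by (rule sum_npts_child_le[OF mn _ ZM]) (use index YZ in \<open>auto simp: Z_def\<close>)
      then show ?thesis
        unfolding RZ N_def M_Suc C_def lm_def P_def card_intmats YZ[symmetric] by simp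
    qed
  qed (use C H P N_def P_def in auto)
  have w_nonneg: "0 \<le> w t" for t
    using C P by (auto simp: w_def N_def \<kappa>_def intro!: sum_nonneg add_nonneg_nonneg)
  have w_le: "w t \<le> w 0 * (P - 1 / 2) ^ t" for t
  proof (induction t)
    case (Suc t)
    have "w (Suc t) \<le> (P - 1 / 2) * (w 0 * (P - 1 / 2) ^ t)"
      using step[of t] mult_left_mono[OF Suc, of "P - 1 / 2"] P by linarith
    then show ?case by (simp add: ac_simps)
  qed simp
  have card_le: "real (card (T t)) \<le> w t" for t
  proof -
    have "real (card (T t)) = (\<Sum>A\<in>T t. 1)" by simp
    also have "\<dots> \<le> w t" unfolding w_def using C P by (intro sum_mono) (auto simp: \<kappa>_def N_def)
    finally show ?thesis .
  qed
  show ?thesis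
  proof (rule that)
    show "0 \<le> w 0" by (rule w_nonneg)
    show "finite (cell m n (2 ^ (?d * l * (k0 + t))) ` X)" for t
      using finT[of t] by (simp only: T_def M_def)
    show "real (card (cell m n (2 ^ (?d * l * (k0 + t))) ` X)) \<le> w 0 * (2 ^ (?d * l * (m * n)) - 1 / 2) ^ t" for t
      using order_trans[OF card_le[of t] w_le[of t]] by (simp only: T_def M_def Peq)
  qed
qed

section \<open>Hausdorff content and cubes of matrices\<close>

lemma mdiam_empty [simp]: "mdiam M {} = 0"
  by (simp add: mdiam_def bot_ennreal)

lemma mdiam_leI:
  assumes "\<And>x y. x \<in> U \<Longrightarrow> y \<in> U \<Longrightarrow> mdist M x y \<le> r"
  shows "mdiam M U \<le> ennreal r"
  unfolding mdiam_def by (intro SUP_least ennreal_leI assms)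

text \<open>The cubes of one generation share a bound \<open>r\<close> on their diameters; padding
  the finite family by empty sets adds nothing to the sum.\<close>

lemma hausdorff_content_eq_0I:
  assumes "0 \<le> s"
    and cover: "\<And>e. 0 < e \<Longrightarrow> \<exists>\<F> r. finite \<F> \<and> 0 \<le> r \<and> r \<le> \<delta> \<and> X \<subseteq> \<Union>\<F> \<and>
      (\<forall>U\<in>\<F>. U \<subseteq> mspace M \<and> mdiam M U \<le> ennreal r) \<and> real (card \<F>) * r powr s \<le> e"
  shows "hausdorff_content M s \<delta> X = 0"
proof -
  have le: "hausdorff_content M s \<delta> X \<le> 0 + ennreal e" if e: "0 < e" for e
  proof -
    obtain \<F> r where F: "finite \<F>" "0 \<le> r" "r \<le> \<delta>" "X \<subseteq> \<Union>\<F>"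
      "\<And>U. U \<in> \<F> \<Longrightarrow> U \<subseteq> mspace M" "\<And>U. U \<in> \<F> \<Longrightarrow> mdiam M U \<le> ennreal r"
      and card: "real (card \<F>) * r powr s \<le> e"
      using cover[OF e] by blast
    obtain h where h: "bij_betw h {0..<card \<F>} \<F>" using ex_bij_betw_nat_finite[OF F(1)] by blast
    define V where "V i = (if i < card \<F> then h i else {})" for i
    have hF: "h i \<in> \<F>" if "i < card \<F>" for i using h that by (auto simp: bij_betw_def)
    have V: "V i \<subseteq> mspace M" "mdiam M (V i) \<le> ennreal r" for i
      using hF F by (auto simp: V_def)
    have "ennreal r \<le> ennreal \<delta>" using F by (intro ennreal_leI)
    then have V\<delta>: "mdiam M (V i) \<le> ennreal \<delta>" for i using V(2) order_trans by blast
    have "X \<subseteq> (\<Union>i. V i)"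
    proof
      fix x assume "x \<in> X"
      then obtain U where U: "U \<in> \<F>" "x \<in> U" using F by blast
      have "U \<in> h ` {0..<card \<F>}" using h U(1) by (simp add: bij_betw_def)
      then obtain i where "i < card \<F>" "U = h i" by auto
      then show "x \<in> (\<Union>i. V i)" using U by (auto simp: V_def)
    qed
    then have "hausdorff_content M s \<delta> X \<le> (\<Sum>i. ennreal (enn2real (mdiam M (V i)) powr s))"
      unfolding hausdorff_content_def using V(1) V\<delta> by (intro INF_lower) blast
    also have "\<dots> = (\<Sum>i<card \<F>. ennreal (enn2real (mdiam M (V i)) powr s))"
      by (intro suminf_finite) (auto simp: V_def)
    also have "\<dots> \<le> (\<Sum>i<card \<F>. ennreal (r powr s))"
    proof (intro sum_mono ennreal_leI powr_mono2)
      fix i show "enn2real (mdiam M (V i)) \<le> r"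
        using V(2)[of i] F(2) by (metis enn2real_ennreal enn2real_mono ennreal_less_top)
    qed (use assms in auto)
    also have "\<dots> = ennreal (real (card \<F>) * r powr s)"
      by (simp add: ennreal_mult'' ennreal_of_nat_eq_real_of_nat)
    also have "\<dots> \<le> ennreal e" using card by (rule ennreal_leI)
    finally show ?thesis by simp
  qed
  have "hausdorff_content M s \<delta> X \<le> 0" by (rule ennreal_le_epsilon) (rule le)
  then show ?thesis by simp
qed

text \<open>Cubes are counted only for a fixed threshold \<open>K\<close>, and box counting does not
  pass to countable unions. The content does: the set of index \<open>n\<close> gets the budget
  \<open>e / 2 ^ (n + 1)\<close>, and pairs are enumerated.\<close>

lemma hausdorff_content_countable_Union_eq_0:
  fixes X :: "nat \<Rightarrow> 'a set"
  assumes zero: "\<And>n. hausdorff_content M s \<delta> (X n) = 0"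
  shows "hausdorff_content M s \<delta> (\<Union>n. X n) = 0"
proof -
  define g where "g U = ennreal (enn2real (mdiam M U) powr s)" for U
  have le: "hausdorff_content M s \<delta> (\<Union>n. X n) \<le> 0 + ennreal e" if e: "0 < e" for e
  proof -
    have "\<exists>U. X n \<subseteq> (\<Union>i. U i) \<and> (\<forall>i. U i \<subseteq> mspace M \<and> mdiam M (U i) \<le> ennreal \<delta>) \<and>
        (\<Sum>i. g (U i)) < ennreal (e * (1 / 2) ^ Suc n)" for n
    proof -
      have "hausdorff_content M s \<delta> (X n) < ennreal (e * (1 / 2) ^ Suc n)"
        using zero e by simp
      then show ?thesis unfolding hausdorff_content_def INF_less_iff g_def by blast
    qed
    then obtain U where U: "\<And>n. X n \<subseteq> (\<Union>i. U n i)"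
      "\<And>n i. U n i \<subseteq> mspace M" "\<And>n i. mdiam M (U n i) \<le> ennreal \<delta>"
      "\<And>n. (\<Sum>i. g (U n i)) < ennreal (e * (1 / 2) ^ Suc n)"
      by metis
    define V where "V k = (case prod_decode k of (n, i) \<Rightarrow> U n i)" for k
    have "(\<Union>n. X n) \<subseteq> (\<Union>k. V k)"
    proof
      fix x assume "x \<in> (\<Union>n. X n)"
      then obtain n i where "x \<in> U n i" using U(1) by blast
      then have "x \<in> V (prod_encode (n, i))" by (simp add: V_def)
      then show "x \<in> (\<Union>k. V k)" by blast
    qed
    then have "hausdorff_content M s \<delta> (\<Union>n. X n) \<le> (\<Sum>k. g (V k))"
      unfolding hausdorff_content_def g_def using U(2,3)
      by (intro INF_lower) (auto simp: V_def split: prod.splits)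
    also have "\<dots> = (\<Sum>n. \<Sum>i. g (U n i))"
      using suminf_ennreal_2dimen[of "\<lambda>n. \<Sum>i. g (U n i)" "\<lambda>(n, i). g (U n i)"]
      by (simp add: V_def case_prod_unfold)
    also have "\<dots> \<le> (\<Sum>n. ennreal (e * (1 / 2) ^ Suc n))"
      using U(4) by (intro suminf_le) (auto intro: less_imp_le)
    also have "\<dots> = ennreal e"
    proof -
      have "(\<lambda>n. e * (1 / 2) ^ Suc n) sums (e * 1)" by (intro sums_mult power_half_series)
      then show ?thesis using e by (intro suminf_ennreal_eq) auto
    qed
    finally show ?thesis by simp
  qed
  have "hausdorff_content M s \<delta> (\<Union>n. X n) \<le> 0" by (rule ennreal_le_epsilon) (rule le)
  then show ?thesis by simp
qed

lemma hausdorff_content_mono: "X \<subseteq> X' \<Longrightarrow> hausdorff_content M s \<delta> X \<le> hausdorff_content M s \<delta> X'"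
  unfolding hausdorff_content_def by (intro INF_superset_mono) auto

lemma hausdorff_dim_le:
  assumes "0 < s" "\<And>\<delta>. 0 < \<delta> \<Longrightarrow> hausdorff_content M s \<delta> X = 0"
  shows "hausdorff_dim M X \<le> ereal s"
proof -
  have "hausdorff_measure M s X \<le> 0"
    unfolding hausdorff_measure_def by (intro SUP_least) (simp add: assms(2))
  then show ?thesis unfolding hausdorff_dim_def using assms(1) by (intro INF_lower) simp
qed

section \<open>Matrices, their cells and the lower limit\<close>

definition entries :: "real mat \<Rightarrow> nat \<Rightarrow> nat \<Rightarrow> real" where
  "entries A = (\<lambda>i j. A $$ (i, j))"

lemma mat_dist_le_if_same_cell:
  assumes "0 < M" "cell m n M (entries A) = cell m n M (entries B)"
  shows "mat_dist m n A B \<le> real (m * n) / real M"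
proof -
  have "mat_dist m n A B \<le> (\<Sum>(i, j)\<in>{..<m} \<times> {..<n}. \<bar>A $$ (i, j) - B $$ (i, j)\<bar>)"
    unfolding mat_dist_def by (rule order_trans[OF L2_set_le_sum_abs]) (simp add: case_prod_unfold)
  also have "\<dots> \<le> (\<Sum>p\<in>{..<m} \<times> {..<n}. 1 / real M)"
  proof (intro sum_mono, clarify)
    fix i j assume ij: "i < m" "j < n"
    have "\<lfloor>real M * A $$ (i, j)\<rfloor> = \<lfloor>real M * B $$ (i, j)\<rfloor>"
      using ij fun_cong[OF fun_cong[OF assms(2)], of i j] by (simp add: cell_def entries_def)
    then have "\<bar>real M * A $$ (i, j) - real M * B $$ (i, j)\<bar> \<le> 1" by linarith
    then have "real M * \<bar>A $$ (i, j) - B $$ (i, j)\<bar> \<le> 1"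
      unfolding right_diff_distrib[symmetric] by (simp only: abs_mult abs_of_nat)
    then show "\<bar>A $$ (i, j) - B $$ (i, j)\<bar> \<le> 1 / real M" using assms(1) by (simp add: field_simps)
  qed
  finally show ?thesis by simp
qed

lemma finite_cells_of_bounded:
  assumes "\<And>a i j. a \<in> X \<Longrightarrow> i < m \<Longrightarrow> j < n \<Longrightarrow> \<bar>a i j\<bar> \<le> real K"
  shows "finite (cell m n M ` X)"
proof (rule finite_subset)
  show "cell m n M ` X \<subseteq> vecs m (\<lambda>_. vecs n (\<lambda>_. {- int (M * K)..int (M * K)}))"
  proof (rule image_subsetI)
    fix a assume a: "a \<in> X"
    have "\<lfloor>real M * a i j\<rfloor> \<in> {- int (M * K)..int (M * K)}" if "i < m" "j < n" for i j
    proof -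
      have "\<bar>real M * a i j\<bar> \<le> real M * real K"
        using assms[OF a that] by (simp add: abs_mult mult_left_mono)
      then have "- real (M * K) \<le> real M * a i j" "real M * a i j \<le> real (M * K)" by auto
      then show ?thesis by (simp add: le_floor_iff floor_le_iff)
    qed
    then show "cell m n M a \<in> vecs m (\<lambda>_. vecs n (\<lambda>_. {- int (M * K)..int (M * K)}))"
      by (auto simp: vecs_def cell_def fun_eq_iff)
  qed
  show "finite (vecs m (\<lambda>_. vecs n (\<lambda>_. {- int (M * K)..int (M * K)})))"
    by (intro finite_vecs) auto
qed

text \<open>In dimension 0, \<open>sup_norm\<close> would be a maximum over the empty set, which is
  unspecified. Its nonnegativity bounds the infimum over \<open>p\<close> from below, so that this
  infimum is at most each value.\<close>

lemma dist_int_nonneg: "1 \<le> dim_vec v \<Longrightarrow> 0 \<le> dist_int v"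
  and dist_int_le: "1 \<le> dim_vec v \<Longrightarrow> p \<in> carrier_vec (dim_vec v) \<Longrightarrow>
    (\<And>i. i < dim_vec v \<Longrightarrow> \<bar>v $ i - real_of_int (p $ i)\<bar> \<le> e) \<Longrightarrow> dist_int v \<le> e"
proof -
  assume v: "1 \<le> dim_vec v"
  have sup: "0 \<le> sup_norm (v - map_vec real_of_int p)" if "p \<in> carrier_vec (dim_vec v)" for p
  proof -
    have "\<bar>(v - map_vec real_of_int p) $ 0\<bar> \<le> sup_norm (v - map_vec real_of_int p)"
      unfolding sup_norm_def using v that by (intro Max_ge) auto
    then show ?thesis by linarith
  qed
  show "0 \<le> dist_int v"
    unfolding dist_int_def using sup zero_carrier_vec by (intro cINF_greatest) blast+
  assume p: "p \<in> carrier_vec (dim_vec v)" and e: "\<And>i. i < dim_vec v \<Longrightarrow> \<bar>v $ i - real_of_int (p $ i)\<bar> \<le> e"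
  have "dist_int v \<le> sup_norm (v - map_vec real_of_int p)"
    unfolding dist_int_def using sup p by (intro cINF_lower bdd_belowI[of _ 0]) auto
  also have "\<dots> \<le> e"
    unfolding sup_norm_def using v p e by (intro Max.boundedI) (auto simp: lessThan_empty_iff)
  finally show "dist_int v \<le> e" .
qed

text \<open>The strict inequality \<open>\<eta> < \<epsilon>\<close> turns the lower limit into a
  bound for all \<open>q\<close> beyond some norm. The same \<open>K\<close> also bounds the
  entries, so that one countable union yields bounded sets, with finitely many cells each.\<close>

lemma Bad_imp_uniformly_bad:
  assumes mn: "1 \<le> m" "1 \<le> n" and b: "b \<in> carrier_vec m" and A: "A \<in> Bad m n b \<epsilon>" and \<eta>: "\<eta> < \<epsilon>"
  obtains K where "entries A \<in> uniformly_bad m n (\<lambda>i. b $ i) \<eta> K"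
    and "\<And>i j. i < m \<Longrightarrow> j < n \<Longrightarrow> \<bar>entries A i j\<bar> \<le> real K"
proof -
  let ?f = "\<lambda>q. sup_norm (map_vec real_of_int q) ^ n * dist_int (A *\<^sub>v map_vec real_of_int q - b) ^ m"
  have AC: "A \<in> carrier_mat m n" using A by (simp add: Bad_def)
  have "ereal \<epsilon> \<le> Liminf (int_vec_at_infinity n) (\<lambda>q. ereal (?f q))" using A by (simp add: Bad_def)
  then have "eventually (\<lambda>q. ereal \<eta> < ereal (?f q)) (int_vec_at_infinity n)"
    using \<eta> by (intro le_Liminf_iff[THEN iffD1, rule_format]) auto
  then obtain K0 where K0: "\<And>q. q \<in> carrier_vec n \<Longrightarrow> K0 \<le> sup_norm (map_vec real_of_int q) \<Longrightarrow> \<eta> < ?f q"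
    unfolding int_vec_at_infinity_def eventually_inf_principal eventually_filtercomap
      eventually_at_top_linorder by auto
  define K where "K = nat \<lceil>\<bar>K0\<bar>\<rceil> + nat \<lceil>\<Sum>i<m. \<Sum>j<n. \<bar>A $$ (i, j)\<bar>\<rceil>"
  have "entries A \<in> uniformly_bad m n (\<lambda>i. b $ i) \<eta> K"
    unfolding uniformly_bad_def
  proof (intro CollectI allI impI, elim conjE)
    fix q p :: "nat \<Rightarrow> int" and Q e
    assume Q: "K \<le> Q" and e: "0 \<le> (e :: real)" and q: "\<forall>j<n. \<bar>q j\<bar> \<le> int Q" "\<exists>j<n. \<bar>q j\<bar> = int Q"
      and approx: "\<forall>i<m. \<bar>(\<Sum>j<n. entries A i j * real_of_int (q j)) - b $ i - real_of_int (p i)\<bar> \<le> e"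
    let ?q = "vec n q"
    have "sup_norm (map_vec real_of_int ?q) = real Q"
      unfolding sup_norm_def
    proof (rule Max_eqI)
      fix y assume "y \<in> (\<lambda>i. \<bar>map_vec real_of_int ?q $ i\<bar>) ` {..<dim_vec (map_vec real_of_int ?q)}"
      then obtain j where "j < n" "y = \<bar>real_of_int (q j)\<bar>" by auto
      then show "y \<le> real Q" using q(1) by (metis of_int_abs of_int_le_iff of_int_of_nat_eq)
    next
      obtain j where j: "j < n" "\<bar>q j\<bar> = int Q" using q(2) by blast
      then have "real Q = \<bar>map_vec real_of_int ?q $ j\<bar>" by (simp add: of_int_abs[symmetric] del: of_int_abs)
      then show "real Q \<in> (\<lambda>i. \<bar>map_vec real_of_int ?q $ i\<bar>) ` {..<dim_vec (map_vec real_of_int ?q)}"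
        using j by (intro image_eqI[of _ _ j]) auto
    qed simp
    note supq = this
    have "K0 \<le> real Q"
    proof -
      have "\<bar>K0\<bar> \<le> real K" unfolding K_def by linarith
      then show ?thesis using Q by linarith
    qed
    then have "\<eta> < ?f ?q" using K0[of ?q] supq by simp
    also have "?f ?q \<le> real Q ^ n * e ^ m"
      unfolding supq
    proof (intro mult_left_mono power_mono)
      let ?v = "A *\<^sub>v map_vec real_of_int ?q - b"
      have dv: "dim_vec ?v = m" using b by simp
      show "dist_int ?v \<le> e"
      proof (rule dist_int_le)
        show "vec m p \<in> carrier_vec (dim_vec ?v)" using dv by simp
        fix i assume "i < dim_vec ?v"
        then have i: "i < m" using dv by simp
        have "?v $ i = (\<Sum>j<n. entries A i j * real_of_int (q j)) - b $ i"
          using i AC b by (simp add: scalar_prod_def entries_def lessThan_atLeast0)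
        then show "\<bar>?v $ i - real_of_int (vec m p $ i)\<bar> \<le> e" using approx i by simp
      qed (use dv mn in simp)
      show "0 \<le> dist_int ?v" by (rule dist_int_nonneg) (use dv mn in simp)
    qed simp
    finally show "\<eta> \<le> real Q ^ n * e ^ m" by simp
  qed
  moreover have "\<bar>entries A i j\<bar> \<le> real K" if "i < m" "j < n" for i j
  proof -
    have "\<bar>A $$ (i, j)\<bar> \<le> (\<Sum>j<n. \<bar>A $$ (i, j)\<bar>)"
      using that by (intro member_le_sum[of j _ "\<lambda>j. \<bar>A $$ (i, j)\<bar>"]) auto
    also have "\<dots> \<le> (\<Sum>i<m. \<Sum>j<n. \<bar>A $$ (i, j)\<bar>)"
      using that by (intro member_le_sum[of i _ "\<lambda>i. \<Sum>j<n. \<bar>A $$ (i, j)\<bar>"]) (auto intro: sum_nonneg)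
    also have "\<dots> \<le> real K" unfolding K_def by linarith
    finally show ?thesis by (simp add: entries_def)
  qed
  ultimately show ?thesis using that by blast
qed

section \<open>The dimension bound\<close>

text \<open>After \<open>t\<close> generations the covering sum of exponent \<open>s\<close> is at
  most a constant times \<open>\<theta> ^ t\<close>, where
  \<open>\<theta> = (1 - 1 / (2 * P)) * 2 powr (?D * c)\<close>. By
  \<open>1 - x \<le> exp (- x)\<close>, the hypothesis \<open>gain\<close> makes
  \<open>\<theta> < 1\<close>.\<close>

lemma hausdorff_dim_Bad_le:
  fixes l :: nat
  assumes mn: "1 \<le> m" "1 \<le> n" and l: "1 \<le> l" and b: "b \<in> carrier_vec m"
    and lam: "height_const m n * (real ((m + n) * l + 1) / 2 ^ l) \<le> 1 / 4"
  defines "H \<equiv> nat \<lceil>12 * height_const m n\<rceil>"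
  assumes small: "(9 * real H) ^ n * ((9 * (real n + 1) * real H + 1) / 2 ^ ((m + n) * l)) ^ m < \<eta>"
    and \<eta>: "\<eta> < \<epsilon>" and c: "c < real (m * n)"
    and gain: "real ((m + n) * l) * ln 2 * c < 1 / (2 * 2 ^ ((m + n) * l * (m * n)))"
  shows "hausdorff_dim (mat_metric m n) (Bad m n b \<epsilon>) \<le> ereal (real (m * n) - c)"
proof (rule hausdorff_dim_le)
  define s where "s = real (m * n) - c"
  let ?D = "(m + n) * l"
  define P :: real where "P = 2 ^ (?D * (m * n))"
  define X where "X K = {A \<in> carrier_mat m n. entries A \<in> uniformly_bad m n (\<lambda>i. b $ i) \<eta> K \<and>
      (\<forall>i<m. \<forall>j<n. \<bar>entries A i j\<bar> \<le> real K)}" for K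
  have s: "0 < s" using c by (simp add: s_def)
  then show "0 < real (m * n) - c" by (simp add: s_def)
  fix \<delta> :: real assume \<delta>: "0 < \<delta>"
  have P: "1 \<le> P" by (simp add: P_def)
  define \<theta> where "\<theta> = (P - 1 / 2) * 2 powr (- (real ?D * s))"
  have \<theta>0: "0 \<le> \<theta>" using P by (simp add: \<theta>_def)
  have \<theta>1: "\<theta> < 1"
  proof -
    have "2 powr (- (real ?D * s)) = 2 powr (real ?D * c) / 2 powr (real (?D * (m * n)))"
      by (simp add: s_def powr_diff[symmetric] algebra_simps)
    also have "2 powr (real (?D * (m * n))) = P"
      unfolding P_def by (rule powr_realpow) simp
    finally have "\<theta> = (P - 1 / 2) * (2 powr (real ?D * c) / P)" by (simp only: \<theta>_def)
    also have "\<dots> = (1 - 1 / (2 * P)) * 2 powr (real ?D * c)"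
    proof -
      have "(P - 1 / 2) * (z / P) = (1 - 1 / (2 * P)) * z" for z
        using P by (simp add: field_simps)
      then show ?thesis .
    qed
    also have "\<dots> \<le> exp (- (1 / (2 * P))) * 2 powr (real ?D * c)"
      using exp_ge_add_one_self[of "- (1 / (2 * P))"] by (intro mult_right_mono) auto
    also have "\<dots> = exp (real ?D * ln 2 * c - 1 / (2 * P))"
      by (simp add: powr_def exp_add[symmetric] mult_ac)
    also have "\<dots> < 1" using gain by (simp add: P_def)
    finally show ?thesis .
  qed
  have "hausdorff_content (mat_metric m n) s \<delta> (X K) = 0" for K
  proof (rule hausdorff_content_eq_0I)
    show "0 \<le> s" using s by simp
    fix e :: real assume e: "0 < e"
    define k0 where "k0 = m + n + K"
    define M :: "nat \<Rightarrow> nat" where "M t = 2 ^ (?D * (k0 + t))" for t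
    define cells where "cells t = cell m n (M t) ` entries ` X K" for t
    have "finite (cell m n (2 ^ (?D * k0)) ` entries ` X K)"
      by (rule finite_cells_of_bounded[where K = K]) (auto simp: X_def)
    moreover have "m + n \<le> k0" "K \<le> k0" by (simp_all add: k0_def)
    moreover have "entries ` X K \<subseteq> uniformly_bad m n (\<lambda>i. b $ i) \<eta> K" by (auto simp: X_def)
    ultimately obtain W where W: "0 \<le> W" "\<And>t. finite (cells t)"
      "\<And>t. real (card (cells t)) \<le> W * (P - 1 / 2) ^ t"
      using card_cells_le[OF mn l lam small[unfolded H_def], of k0 K "entries ` X K" "\<lambda>i. b $ i"]
      unfolding cells_def M_def P_def by metis
    define r where "r t = real (m * n) / real (M t)" for t
    have r0: "0 \<le> r t" for t by (simp add: r_def)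
    define G where "G = W * (real (m * n) powr s * 2 powr (- (real (?D * k0) * s)))"
    have r_powr: "W * (P - 1 / 2) ^ t * r t powr s = G * \<theta> ^ t" for t
    proof -
      have "real (M t) = 2 powr (real (?D * (k0 + t)))"
        unfolding M_def by (simp only: of_nat_power of_nat_numeral powr_realpow zero_less_numeral)
      then have "r t powr s = real (m * n) powr s * 2 powr (- (real (?D * (k0 + t)) * s))"
        by (simp add: r_def powr_divide powr_powr powr_minus_divide)
      also have "2 powr (- (real (?D * (k0 + t)) * s)) = 2 powr (- (real (?D * k0) * s)) * (2 powr (- (real ?D * s))) ^ t"
        by (simp add: powr_power powr_add[symmetric] algebra_simps)
      finally show ?thesis by (simp add: G_def \<theta>_def power_mult_distrib)
    qed
    have "(\<lambda>t. G * \<theta> ^ t) \<longlonglongrightarrow> G * 0"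
      using \<theta>0 \<theta>1 by (intro tendsto_mult_left LIMSEQ_realpow_zero)
    then have ev1: "eventually (\<lambda>t. G * \<theta> ^ t < e) sequentially"
      using e by (intro order_tendstoD(2)) auto
    have "r \<longlonglongrightarrow> 0"
    proof (rule tendsto_sandwich[where f = "\<lambda>_. 0" and h = "\<lambda>t. real (m * n) * (1 / 2) ^ t"])
      show "eventually (\<lambda>t. r t \<le> real (m * n) * (1 / 2) ^ t) sequentially"
      proof (intro always_eventually allI)
        fix t
        have "t \<le> ?D * (k0 + t)" using mn l by (cases "(m + n) * l") auto
        then have "(2::real) ^ t \<le> real (M t)" by (simp add: M_def power_increasing)
        then have "real (m * n) / real (M t) \<le> real (m * n) / 2 ^ t" by (intro divide_left_mono) (auto simp: M_def)
        then show "r t \<le> real (m * n) * (1 / 2) ^ t" by (simp add: r_def power_divide)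
      qed
      have "(\<lambda>t. real (m * n) * (1 / 2) ^ t) \<longlonglongrightarrow> real (m * n) * 0"
        by (intro tendsto_mult_left LIMSEQ_realpow_zero) auto
      then show "(\<lambda>t. real (m * n) * (1 / 2) ^ t) \<longlonglongrightarrow> 0" by simp
    qed (use r0 in auto)
    then have ev2: "eventually (\<lambda>t. r t < \<delta>) sequentially"
      using \<delta> by (rule order_tendstoD(2))
    obtain t where t: "G * \<theta> ^ t < e" "r t < \<delta>"
      using eventually_happens'[OF sequentially_bot eventually_conj[OF ev1 ev2]] by blast
    define U where "U C = {A \<in> X K. cell m n (M t) (entries A) = C}" for C
    have "finite (U ` cells t)" using W(2) by simp
    moreover have "X K \<subseteq> \<Union> (U ` cells t)" by (auto simp: U_def cells_def)
    moreover have "V \<subseteq> mspace (mat_metric m n) \<and> mdiam (mat_metric m n) V \<le> ennreal (r t)"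
      if V: "V \<in> U ` cells t" for V
    proof
      show "V \<subseteq> mspace (mat_metric m n)" using V by (auto simp: U_def X_def)
      show "mdiam (mat_metric m n) V \<le> ennreal (r t)"
        unfolding r_def
      proof (rule mdiam_leI)
        fix A B assume "A \<in> V" "B \<in> V"
        then have "cell m n (M t) (entries A) = cell m n (M t) (entries B)" using V by (auto simp: U_def)
        then show "mdist (mat_metric m n) A B \<le> real (m * n) / real (M t)"
          using mat_dist_le_if_same_cell[of "M t" m n A B] by (simp add: M_def)
      qed
    qed
    moreover have "real (card (U ` cells t)) * r t powr s \<le> e"
    proof -
      have "real (card (U ` cells t)) \<le> real (card (cells t))" using W(2) by (simp add: card_image_le)
      also have "\<dots> \<le> W * (P - 1 / 2) ^ t" by (rule W(3))
      finally have "real (card (U ` cells t)) * r t powr s \<le> W * (P - 1 / 2) ^ t * r t powr s"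
        by (rule mult_right_mono) simp
      then show ?thesis using t(1) r_powr[of t] by linarith
    qed
    ultimately show "\<exists>\<F> r. finite \<F> \<and> 0 \<le> r \<and> r \<le> \<delta> \<and> X K \<subseteq> \<Union>\<F> \<and>
      (\<forall>U\<in>\<F>. U \<subseteq> mspace (mat_metric m n) \<and> mdiam (mat_metric m n) U \<le> ennreal r) \<and>
      real (card \<F>) * r powr s \<le> e"
      using r0[of t] t(2) by (intro exI[of _ "U ` cells t"] exI[of _ "r t"]) auto
  qed
  then have "hausdorff_content (mat_metric m n) s \<delta> (\<Union>K. X K) = 0"
    by (rule hausdorff_content_countable_Union_eq_0)
  moreover have "Bad m n b \<epsilon> \<subseteq> (\<Union>K. X K)"
  proof
    fix A assume A: "A \<in> Bad m n b \<epsilon>"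
    then have "A \<in> carrier_mat m n" by (simp add: Bad_def)
    moreover obtain K where "entries A \<in> uniformly_bad m n (\<lambda>i. b $ i) \<eta> K"
      "\<And>i j. i < m \<Longrightarrow> j < n \<Longrightarrow> \<bar>entries A i j\<bar> \<le> real K"
      using Bad_imp_uniformly_bad[OF mn b A \<eta>] by blast
    ultimately show "A \<in> (\<Union>K. X K)" by (auto simp: X_def)
  qed
  ultimately show "hausdorff_content (mat_metric m n) (real (m * n) - c) \<delta> (Bad m n b \<epsilon>) = 0"
    using hausdorff_content_mono[of "Bad m n b \<epsilon>" "\<Union>K. X K" "mat_metric m n" s \<delta>]
    by (simp add: s_def)
qed

section \<open>Choice of the scale and of the constants\<close>

lemma hausdorff_dim_mono:
  assumes "X \<subseteq> X'" shows "hausdorff_dim M X \<le> hausdorff_dim M X'"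
proof -
  have "hausdorff_measure M s X \<le> hausdorff_measure M s X'" for s
    unfolding hausdorff_measure_def by (intro SUP_mono') (rule hausdorff_content_mono[OF assms])
  then have "hausdorff_measure M s X = 0" if "hausdorff_measure M s X' = 0" for s
    using that by (metis le_zero_eq)
  then show ?thesis unfolding hausdorff_dim_def by (intro INF_superset_mono) auto
qed

lemma Bad_antimono: "\<epsilon>' \<le> \<epsilon> \<Longrightarrow> Bad m n b \<epsilon> \<subseteq> Bad m n b \<epsilon>'"
  unfolding Bad_def by (auto intro: order_trans[of "ereal \<epsilon>'" "ereal \<epsilon>"])

text \<open>The scale \<open>2 ^ l\<close> is taken between \<open>K / \<epsilon>\<close> and
  \<open>2 * K / \<epsilon>\<close>: the lower bound produces dead subcubes, the upper bound keeps
  the gain \<open>1 / 2 ^ (l * D)\<close> a power of \<open>\<epsilon>\<close>. The extra 1 in the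
  exponent pays for the factor \<open>l\<close> in \<open>gain\<close>, since
  \<open>l * ln 2 < 2 ^ l\<close>.\<close>

lemma hausdorff_dim_Bad_le_power:
  assumes mn: "1 \<le> m" "1 \<le> n"
  obtains c where "0 < c" "c \<le> 1 / 2"
    and "\<And>\<epsilon> b. 0 < \<epsilon> \<Longrightarrow> \<epsilon> \<le> 1 \<Longrightarrow> b \<in> carrier_vec m \<Longrightarrow>
      hausdorff_dim (mat_metric m n) (Bad m n b \<epsilon>)
        \<le> ereal (real (m * n) - c * \<epsilon> ^ ((m + n) * (m * n) + 1))"
proof -
  define H where "H = nat \<lceil>12 * height_const m n\<rceil>"
  define B where "B = 9 * (real n + 1) * real H + 1"
  define D where "D = (m + n) * (m * n)"
  have B: "1 \<le> B" by (simp add: B_def)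
  have "(\<lambda>l. height_const m n * (real (m + n) * (real l * (1 / 2) ^ l) + (1 / 2) ^ l)) \<longlonglongrightarrow>
      height_const m n * (real (m + n) * 0 + 0)"
    by (intro tendsto_intros powser_times_n_limit_0 LIMSEQ_realpow_zero) auto
  then have "eventually (\<lambda>l. height_const m n * (real (m + n) * (real l * (1 / 2) ^ l) + (1 / 2) ^ l) < 1 / 4) sequentially"
    by (intro order_tendstoD(2)) auto
  then obtain l0 where l0: "\<And>l. l0 \<le> l \<Longrightarrow>
      height_const m n * (real (m + n) * (real l * (1 / 2) ^ l) + (1 / 2) ^ l) < 1 / 4"
    unfolding eventually_sequentially by blast
  \<comment> \<open>One summand per demand: \<open>l\<close> beyond \<open>l0\<close>, a base at
    most 1 for the \<open>m\<close>-th power in \<open>small\<close>, the bound by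
    \<open>\<epsilon> / 2\<close>, and a final 1 for strictness.\<close>
  define K where "K = 2 ^ (l0 + 1) + B + 2 * (9 * real H) ^ n * B + 1"
  have HB: "0 \<le> 2 * (9 * real H) ^ n * B" using B by simp
  have K: "2 ^ (l0 + 1) \<le> K" "B \<le> K" "2 * (9 * real H) ^ n * B < K" "1 \<le> K"
  proof -
    have "(0 :: real) < 2 ^ (l0 + 1)" by simp
    then show "2 ^ (l0 + 1) \<le> K" "B \<le> K" "2 * (9 * real H) ^ n * B < K" "1 \<le> K"
      unfolding K_def using B HB by linarith+
  qed
  \<comment> \<open>The power comes from \<open>\<epsilon> / (2 * K) \<le> 1 / 2 ^ l\<close>;
    dividing by \<open>2 * (m + n)\<close> cancels the \<open>m + n\<close> in \<open>gain\<close>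
    and supplies its 2.\<close>
  define c where "c = (1 / (2 * K)) ^ (D + 1) / (2 * real (m + n))"
  have c: "0 < c" using K mn by (simp add: c_def)
  have "(1 / (2 * K)) ^ (D + 1) \<le> 1" using K by (intro power_le_one) auto
  then have "c \<le> 1 / (2 * real (m + n))" unfolding c_def using mn by (intro divide_right_mono) auto
  also have "\<dots> \<le> 1 / 2" using mn by (intro divide_left_mono) auto
  finally have c2: "c \<le> 1 / 2" .
  have "hausdorff_dim (mat_metric m n) (Bad m n b \<epsilon>) \<le> ereal (real (m * n) - c * \<epsilon> ^ (D + 1))"
    if \<epsilon>: "0 < \<epsilon>" "\<epsilon> \<le> 1" and b: "b \<in> carrier_vec m" for \<epsilon> b
  proof -
    define l where "l = (LEAST l. K / \<epsilon> \<le> 2 ^ l)"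
    obtain l' where "K / \<epsilon> < 2 ^ l'" using real_arch_pow[of 2 "K / \<epsilon>"] by auto
    then have l_ge: "K / \<epsilon> \<le> 2 ^ l"
      unfolding l_def by (intro LeastI[of "\<lambda>l. K / \<epsilon> \<le> 2 ^ l" l']) simp
    have "K \<le> K / \<epsilon>" using \<epsilon> K by (simp add: pos_le_divide_eq mult_left_le)
    then have Kl: "K \<le> 2 ^ l" using l_ge by linarith
    have "l0 + 1 \<le> l"
    proof -
      have "(2::real) ^ (l0 + 1) \<le> 2 ^ l" using K Kl by linarith
      then show ?thesis by (simp only: power_increasing_iff)
    qed
    then have l: "1 \<le> l" "l0 \<le> l" by simp_all
    have l_le: "2 ^ l \<le> 2 * K / \<epsilon>"
    proof -
      obtain l1 where l1: "l = Suc l1" using l by (cases l) auto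
      then have "\<not> K / \<epsilon> \<le> 2 ^ l1" using not_less_Least[of l1 "\<lambda>l. K / \<epsilon> \<le> 2 ^ l"] by (simp add: l_def)
      then show ?thesis by (simp add: l1)
    qed
    show ?thesis
    proof (rule hausdorff_dim_Bad_le[where l = l and \<eta> = "\<epsilon> / 2", OF mn l(1) b])
      have "real ((m + n) * l + 1) / 2 ^ l = real (m + n) * (real l * (1 / 2) ^ l) + (1 / 2) ^ l"
        by (simp add: power_divide add_divide_distrib)
      then show "height_const m n * (real ((m + n) * l + 1) / 2 ^ l) \<le> 1 / 4"
        using l0[OF l(2)] by simp
      have le: "(2::real) ^ l \<le> 2 ^ ((m + n) * l)" using mn by (intro power_increasing) auto
      have "(B / 2 ^ ((m + n) * l)) ^ m \<le> B / 2 ^ ((m + n) * l)"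
      proof -
        have "B \<le> 2 ^ ((m + n) * l)" using K(2) Kl le by linarith
        then have "B / 2 ^ ((m + n) * l) \<le> 1" by simp
        then show ?thesis using power_decreasing[of 1 m "B / 2 ^ ((m + n) * l)"] mn B by simp
      qed
      also have "\<dots> \<le> B / 2 ^ l" using le B by (intro divide_left_mono) auto
      finally have "(9 * real H) ^ n * (B / 2 ^ ((m + n) * l)) ^ m \<le> (9 * real H) ^ n * (B / 2 ^ l)"
        by (rule mult_left_mono) simp
      also have "\<dots> < \<epsilon> / 2"
      proof -
        have "2 * (9 * real H) ^ n * B < \<epsilon> * 2 ^ l"
          using K(3) l_ge \<epsilon> by (simp add: pos_divide_le_eq mult.commute)
        then show ?thesis by (simp add: field_simps)
      qed
      finally show "(9 * real (nat \<lceil>12 * height_const m n\<rceil>)) ^ n *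
          ((9 * (real n + 1) * real (nat \<lceil>12 * height_const m n\<rceil>) + 1) / 2 ^ ((m + n) * l)) ^ m < \<epsilon> / 2"
        by (simp add: B_def H_def)
      show "\<epsilon> / 2 < \<epsilon>" using \<epsilon> by simp
      have "\<epsilon> ^ (D + 1) \<le> 1" using \<epsilon> by (intro power_le_one) auto
      then have "c * \<epsilon> ^ (D + 1) \<le> 1 / 2" using c c2 mult_left_mono[of "\<epsilon> ^ (D + 1)" 1 c] by linarith
      also have "\<dots> < real (m * n)"
      proof -
        have "1 \<le> m * n" using mn by simp
        then have "1 \<le> real (m * n)" by (metis of_nat_1 of_nat_le_iff)
        then show ?thesis by linarith
      qed
      finally show "c * \<epsilon> ^ (D + 1) < real (m * n)" .
      have "\<epsilon> / (2 * K) \<le> 1 / 2 ^ l" using l_le K \<epsilon> by (simp add: field_simps)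
      then have "(\<epsilon> / (2 * K)) ^ (D + 1) \<le> (1 / 2 ^ l) ^ (D + 1)" using \<epsilon> K by (intro power_mono) auto
      then have "c * \<epsilon> ^ (D + 1) \<le> (1 / 2 ^ l) ^ (D + 1) / (2 * real (m + n))"
      proof -
        have "c * \<epsilon> ^ (D + 1) = (\<epsilon> / (2 * K)) ^ (D + 1) / (2 * real (m + n))"
          unfolding c_def by (simp add: power_divide)
        then show ?thesis
          using \<open>(\<epsilon> / (2 * K)) ^ (D + 1) \<le> (1 / 2 ^ l) ^ (D + 1)\<close> by (simp only: divide_right_mono of_nat_0_le_iff zero_le_mult_iff zero_le_numeral simp_thms)
      qed
      then have "real ((m + n) * l) * ln 2 * (c * \<epsilon> ^ (D + 1))
          \<le> real ((m + n) * l) * ln 2 * ((1 / 2 ^ l) ^ (D + 1) / (2 * real (m + n)))"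
        by (rule mult_left_mono) simp
      also have "\<dots> = real l * ln 2 * (1 / 2 ^ l) * ((1 / 2 ^ l) ^ D / 2)"
      proof -
        have N: "real (m + n) \<noteq> 0" using mn by simp
        have "N * x * y * (z ^ (D + 1) / (2 * N)) = x * y * z * (z ^ D / 2)" if "N \<noteq> 0" for N x y z :: real
          using that by (simp add: field_simps)
        from this[OF N, of "real l" "ln 2" "1 / 2 ^ l"] show ?thesis by (simp only: of_nat_mult)
      qed
      also have "\<dots> < 1 * ((1 / 2 ^ l) ^ D / 2)"
      proof (rule mult_strict_right_mono)
        have "real l * ln 2 \<le> real l * 1" using ln_2_less_1 by (intro mult_left_mono) auto
        also have "\<dots> < 2 ^ l" by (simp add: of_nat_less_two_power)
        finally show "real l * ln 2 * (1 / 2 ^ l) < 1" by simp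
      qed simp
      also have "\<dots> = 1 / (2 * 2 ^ ((m + n) * l * (m * n)))"
        by (simp add: D_def power_one_over power_mult[symmetric] mult_ac)
      finally show "real ((m + n) * l) * ln 2 * (c * \<epsilon> ^ (D + 1)) < 1 / (2 * 2 ^ ((m + n) * l * (m * n)))" .
    qed
  qed
  then show ?thesis using that[of c] c c2 by (simp add: D_def)
qed

text \<open>For large \<open>\<epsilon>\<close> the bound with \<open>\<epsilon>\<close> itself
  would be negative, while \<open>hausdorff_dim\<close> never is; hence
  \<open>min \<epsilon> 1\<close>, to which \<open>Bad_antimono\<close> reduces. Only finitely many
  pairs have sum \<open>d\<close>, so \<open>c0\<close> can be a minimum over them;
  \<open>M0 = d ^ 3 + 1\<close> dominates all exponents \<open>d * (m * n) + 1\<close>, as a base at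
  most 1 allows.\<close>

theorem theorem1p1:
  fixes d :: nat
  assumes "d \<ge> 2"
  shows "\<exists>c0 M0 :: real. c0 > 0 \<and> M0 > 0 \<and>
           (\<forall>m n :: nat. m \<ge> 1 \<longrightarrow> n \<ge> 1 \<longrightarrow> m + n = d \<longrightarrow>
              (\<forall>\<epsilon> > 0. \<forall>b \<in> carrier_vec m.
                 hausdorff_dim (mat_metric m n) (Bad m n b \<epsilon>)
                   \<le> ereal (real (m * n) - c0 * min \<epsilon> 1 powr M0)))"
proof -
  have "\<exists>c. 0 < c \<and> (\<forall>\<epsilon> b. 0 < \<epsilon> \<and> \<epsilon> \<le> 1 \<and> b \<in> carrier_vec m \<longrightarrow>
      hausdorff_dim (mat_metric m (d - m)) (Bad m (d - m) b \<epsilon>)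
        \<le> ereal (real (m * (d - m)) - c * \<epsilon> ^ (d * (m * (d - m)) + 1)))" if "m \<in> {1..<d}" for m
    using that hausdorff_dim_Bad_le_power[of m "d - m"] by (metis atLeastLessThan_iff le_add_diff_inverse less_imp_le_nat zero_less_diff Suc_leI One_nat_def)
  then obtain c where c: "\<And>m. m \<in> {1..<d} \<Longrightarrow> 0 < c m"
    and dim: "\<And>m \<epsilon> b. m \<in> {1..<d} \<Longrightarrow> 0 < \<epsilon> \<Longrightarrow> \<epsilon> \<le> 1 \<Longrightarrow> b \<in> carrier_vec m \<Longrightarrow>
      hausdorff_dim (mat_metric m (d - m)) (Bad m (d - m) b \<epsilon>)
        \<le> ereal (real (m * (d - m)) - c m * \<epsilon> ^ (d * (m * (d - m)) + 1))"
    by metis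
  define c0 where "c0 = Min (c ` {1..<d})"
  define M0 where "M0 = d * (d * d) + 1"
  have "c0 \<in> c ` {1..<d}" unfolding c0_def using assms by (intro Min_in) auto
  then have c0: "0 < c0" using c by auto
  have "hausdorff_dim (mat_metric m n) (Bad m n b \<epsilon>) \<le> ereal (real (m * n) - c0 * min \<epsilon> 1 powr real M0)"
    if mn: "1 \<le> m" "1 \<le> n" "m + n = d" and \<epsilon>: "0 < \<epsilon>" and b: "b \<in> carrier_vec m" for m n \<epsilon> b
  proof -
    define \<epsilon>' where "\<epsilon>' = min \<epsilon> 1"
    have \<epsilon>': "0 < \<epsilon>'" "\<epsilon>' \<le> 1" "\<epsilon>' \<le> \<epsilon>" using \<epsilon> by (auto simp: \<epsilon>'_def)
    have m: "m \<in> {1..<d}" and n: "n = d - m" using mn by auto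
    have "hausdorff_dim (mat_metric m n) (Bad m n b \<epsilon>) \<le> hausdorff_dim (mat_metric m n) (Bad m n b \<epsilon>')"
      by (rule hausdorff_dim_mono) (rule Bad_antimono[OF \<epsilon>'(3)])
    also have "\<dots> \<le> ereal (real (m * n) - c m * \<epsilon>' ^ (d * (m * n) + 1))"
      unfolding n by (rule dim[OF m \<epsilon>'(1,2) b])
    also have "\<dots> \<le> ereal (real (m * n) - c0 * \<epsilon>' powr real M0)"
    proof -
      have "m * n \<le> d * d" using mn by (intro mult_mono) auto
      then have "d * (m * n) + 1 \<le> M0" unfolding M0_def by simp
      then have "\<epsilon>' ^ M0 \<le> \<epsilon>' ^ (d * (m * n) + 1)" using \<epsilon>' by (intro power_decreasing) auto
      moreover have "c0 \<le> c m" unfolding c0_def using m by (intro Min_le) auto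
      ultimately have "c0 * \<epsilon>' ^ M0 \<le> c m * \<epsilon>' ^ (d * (m * n) + 1)"
        using c0 \<epsilon>' c[OF m] by (intro mult_mono) auto
      then show ?thesis using \<epsilon>' by (simp add: powr_realpow)
    qed
    finally show ?thesis by (simp add: \<epsilon>'_def)
  qed
  moreover have "0 < real M0" unfolding of_nat_0_less_iff M0_def by simp
  ultimately show ?thesis using c0 by blast
qed

end
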